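(* Let $G$ and $H$ be multiplicative Lie algebras acting compatibly on each other. If $H$ is Lie nilpotent of class $n$, then the quotient multiplicative Lie algebra $\dfrac{G\otimes H}{{}^L[H,G]\otimes\langle G,H\rangle}$ is also Lie nilpotent, of class $\le n+1$.
   Context: Multiplicative Lie algebra: a set $G$ with two binary operations $\cdot,\star$ such that $(G,\cdot)$ is a group (not necessarily abelian) and, for all $x,y,z\in G$, with ${}^zx:=zxz^{-1}$: $x\star x=1$; $x\star(yz)=(x\star y)\,{}^y(x\star z)$; $(xy)\star z={}^x(y\star z)\,(x\star z)$; $((x\star y)\star{}^yz)((y\star z)\star{}^zx)((z\star x)\star{}^xy)=1$; ${}^z(x\star y)={}^zx\star{}^zy$. Commutators are $[a,b]=aba^{-1}b^{-1}$. An ideal of $G$ is a normal subgroup $I$ with $g\star a\in I$ for all $g\in G$, $a\in I$; quotients by ideals are again multiplicative Lie algebras. Actions: multiplicative Lie algebras $G$ and $H$ act on each other if the underlying groups act on each other by group automorphisms (written ${}^xy\in H$ and ${}^yx\in G$ for $x\in G,y\in H$; within $G$ or within $H$ superscripts denote conjugation) together with a map $G\times H\to H$, $(x,y)\mapsto\langle x,y\rangle$, satisfying for $x,x'\in G$, $y,y'\in H$: $\langle x,yy'\rangle=\langle x,y\rangle\langle{}^yx,{}^yy'\rangle$; $\langle xx',y\rangle=\langle{}^xx',{}^xy\rangle\langle x,y\rangle$; $\langle x\star x',{}^{x'}y\rangle\,\langle{}^yx,\langle x',y\rangle\rangle^{-1}\langle{}^xx',\langle x,y\rangle^{-1}\rangle^{-1}=1$;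 $\langle{}^{y'}x,y\star y'\rangle\,\langle\langle y,x\rangle^{-1},{}^yy'\rangle^{-1}\langle\langle y',x\rangle,{}^xy\rangle^{-1}=1$; and a map $H\times G\to G$, $(y,x)\mapsto\langle y,x\rangle$, satisfying the same conditions with the roles of $G$ and $H$ exchanged. Superscripts that are products of elements of $G$ and $H$ mean successive action, e.g. ${}^{ghg^{-1}}g'={}^g({}^h({}^{g^{-1}}g'))$. The actions are compatible if for all $g,g'\in G$, $h,h'\in H$: (1) ${}^{({}^gh)}g'={}^{ghg^{-1}}g'$ and ${}^{({}^hg)}h'={}^{hgh^{-1}}h'$; (2) $\langle\langle h,g\rangle^{-1},h'\rangle=\langle g,h\rangle\star h'$ and $\langle\langle g,h\rangle^{-1},g'\rangle=\langle h,g\rangle\star g'$; (3) ${}^{\langle g,h\rangle\langle h,g\rangle}h'=h'$ and ${}^{\langle g,h\rangle\langle h,g\rangle}g'=g'$; (4) ${}^g\langle h,g'\rangle=\langle{}^gh,{}^gg'\rangle$ and ${}^h\langle g,h'\rangle=\langle{}^hg,{}^hh'\rangle$; (5) $\langle g\,{}^hg^{-1},h'\rangle=({}^ghh^{-1})\star h'$ and $\langle h\,{}^gh^{-1},g'\rangle=({}^hgg^{-1})\star g'$. Notation: ${}^L[h,g]=\langle h,g\rangle^{-1}({}^hg\,g^{-1})\in G$; ${}^L[H,G]$ is the subgroup of $G$ generated by all ${}^L[h,g]$ ($h\in H,g\in G$), an ideal of $G$; $\langle G,H\rangle$ is the subgroup of $H$ generated by all $\langle g,h\rangle$, an ideal of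 $H$. Tensor product: $G\otimes H$ is the multiplicative Lie algebra generated by symbols $x\otimes y$ ($x\in G,y\in H$) subject to, for all $x,x'\in G$, $y,y'\in H$: $x\otimes yy'=(x\otimes y)({}^yx\otimes{}^yy')$; $xx'\otimes y=({}^xx'\otimes{}^xy)(x\otimes y)$; $((x\star x')\otimes{}^{x'}y)({}^yx\otimes\langle x',y\rangle)^{-1}({}^xx'\otimes\langle x,y\rangle^{-1})^{-1}=1$; $({}^{y'}x\otimes(y\star y'))(\langle y,x\rangle^{-1}\otimes{}^yy')^{-1}(\langle y',x\rangle\otimes{}^xy)^{-1}=1$; $(x\otimes y)\star(x'\otimes y')=\langle y,x\rangle^{-1}\otimes\langle x',y'\rangle$. For ideals $I$ of $G$ and $J$ of $H$, $I\otimes J$ denotes the subgroup of $G\otimes H$ generated by the elements $a\otimes b$ with $a\in I$, $b\in J$; ${}^L[H,G]\otimes\langle G,H\rangle$ is meant in this sense and is treated as an ideal of $G\otimes H$. Lie nilpotency: for a multiplicative Lie algebra $K$ and $a,b\in K$ put ${}^L[a,b]=(a\star b)^{-1}[a,b]$; $L_0(K)=K$ and $L_{k+1}(K)={}^L[K,L_k(K)]$, the ideal of $K$ generated by all ${}^L[a,b]$ with $a\in K$, $b\in L_k(K)$. $K$ is Lie nilpotent if $L_n(K)=\{1\}$ for some $n$; its class is the least such $n$. *)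

theory Defs
  imports "HOL-Algebra.Coset" "HOL-Algebra.Bij" "HOL-Algebra.Generated_Groups"
begin

section \<open>Multiplicative Lie algebras\<close>

record 'a mult_lie = "'a monoid" +
  star :: "'a \<Rightarrow> 'a \<Rightarrow> 'a"  (infixl \<open>\<star>\<index>\<close> 70)

definition conjugate :: "('a, 'm) monoid_scheme \<Rightarrow> 'a \<Rightarrow> 'a \<Rightarrow> 'a"  (infixr \<open>\<triangleright>\<index>\<close> 75)
  where "z \<triangleright>\<^bsub>K\<^esub> x = z \<otimes>\<^bsub>K\<^esub> x \<otimes>\<^bsub>K\<^esub> inv\<^bsub>K\<^esub> z"

locale mult_lie_algebra = group K for K (structure) +
  assumes star_closed [intro, simp]:
      "\<lbrakk>x \<in> carrier K; y \<in> carrier K\<rbrakk> \<Longrightarrow> x \<star> y \<in> carrier K"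
    and star_self: "x \<in> carrier K \<Longrightarrow> x \<star> x = \<one>"
    and star_mult_right:
      "\<lbrakk>x \<in> carrier K; y \<in> carrier K; z \<in> carrier K\<rbrakk> \<Longrightarrow>
        x \<star> (y \<otimes> z) = (x \<star> y) \<otimes> (y \<triangleright> (x \<star> z))"
    and star_mult_left:
      "\<lbrakk>x \<in> carrier K; y \<in> carrier K; z \<in> carrier K\<rbrakk> \<Longrightarrow>
        (x \<otimes> y) \<star> z = (x \<triangleright> (y \<star> z)) \<otimes> (x \<star> z)"
    and star_jacobi:
      "\<lbrakk>x \<in> carrier K; y \<in> carrier K; z \<in> carrier K\<rbrakk> \<Longrightarrow>
        ((x \<star> y) \<star> (y \<triangleright> z)) \<otimes> ((y \<star> z) \<star> (z \<triangleright> x)) \<otimes> ((z \<star> x) \<star> (x \<triangleright> y)) = \<one>"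
    and conjugate_star:
      "\<lbrakk>x \<in> carrier K; y \<in> carrier K; z \<in> carrier K\<rbrakk> \<Longrightarrow>
        z \<triangleright> (x \<star> y) = (z \<triangleright> x) \<star> (z \<triangleright> y)"

definition lie_ideal :: "'a set \<Rightarrow> ('a, 'm) mult_lie_scheme \<Rightarrow> bool"
  where "lie_ideal I K \<longleftrightarrow> I \<lhd> K \<and> (\<forall>g\<in>carrier K. \<forall>a\<in>I. g \<star>\<^bsub>K\<^esub> a \<in> I)"

definition lie_ideal_generated :: "('a, 'm) mult_lie_scheme \<Rightarrow> 'a set \<Rightarrow> 'a set"
  where "lie_ideal_generated K S = \<Inter> {I. lie_ideal I K \<and> S \<subseteq> I}"

(* The carrier, product and unit are those of K Mod I. If I is a lie_ideal, then
   the star of two cosets is the coset of the star of any two representatives. *)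
definition lie_quotient :: "('a, 'm) mult_lie_scheme \<Rightarrow> 'a set \<Rightarrow> 'a set mult_lie"
  where "lie_quotient K I =
    \<lparr>carrier = carrier (K Mod I), monoid.mult = monoid.mult (K Mod I), one = one (K Mod I),
     star = (\<lambda>A B. \<Union>a\<in>A. \<Union>b\<in>B. I #>\<^bsub>K\<^esub> (a \<star>\<^bsub>K\<^esub> b))\<rparr>"


section \<open>Lie nilpotency\<close>

definition commutator :: "('a, 'm) monoid_scheme \<Rightarrow> 'a \<Rightarrow> 'a \<Rightarrow> 'a"
  where "commutator K a b = a \<otimes>\<^bsub>K\<^esub> b \<otimes>\<^bsub>K\<^esub> inv\<^bsub>K\<^esub> a \<otimes>\<^bsub>K\<^esub> inv\<^bsub>K\<^esub> b"

definition lie_commutator :: "('a, 'm) mult_lie_scheme \<Rightarrow> 'a \<Rightarrow> 'a \<Rightarrow> 'a"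
  where "lie_commutator K a b = inv\<^bsub>K\<^esub> (a \<star>\<^bsub>K\<^esub> b) \<otimes>\<^bsub>K\<^esub> commutator K a b"

primrec lie_lower_central :: "('a, 'm) mult_lie_scheme \<Rightarrow> nat \<Rightarrow> 'a set" where
  "lie_lower_central K 0 = carrier K"
| "lie_lower_central K (Suc k) =
    lie_ideal_generated K {lie_commutator K a b | a b. a \<in> carrier K \<and> b \<in> lie_lower_central K k}"

definition lie_nilpotent :: "('a, 'm) mult_lie_scheme \<Rightarrow> bool"
  where "lie_nilpotent K \<longleftrightarrow>
    mult_lie_algebra K \<and> (\<exists>n. lie_lower_central K n = {\<one>\<^bsub>K\<^esub>})"

(* Meaningful only if K is lie_nilpotent. *)
definition lie_nilpotency_class :: "('a, 'm) mult_lie_scheme \<Rightarrow> nat"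
  where "lie_nilpotency_class K = (LEAST n. lie_lower_central K n = {\<one>\<^bsub>K\<^esub>})"


section \<open>Actions\<close>

(* \<alpha> g h and \<beta> h g are the actions of G on H and of H on G;
   f g h = <g,h> in H and k h g = <h,g> in G.
   This locale contains the conditions on f; those on k are the same conditions with
   the roles of G and H exchanged. *)
locale lie_action =
  G: mult_lie_algebra G + H: mult_lie_algebra H
  for G :: "('a, 'm) mult_lie_scheme" and H :: "('b, 'n) mult_lie_scheme" +
  fixes \<alpha> :: "'a \<Rightarrow> 'b \<Rightarrow> 'b" and \<beta> :: "'b \<Rightarrow> 'a \<Rightarrow> 'a"
    and f :: "'a \<Rightarrow> 'b \<Rightarrow> 'b" and k :: "'b \<Rightarrow> 'a \<Rightarrow> 'a"
  assumes act_hom: "\<alpha> \<in> hom G (AutoGroup H)"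
    and bracket_closed: "f \<in> carrier G \<rightarrow> carrier H \<rightarrow> carrier H"
    and bracket_mult_right:
      "\<lbrakk>x \<in> carrier G; y \<in> carrier H; y' \<in> carrier H\<rbrakk> \<Longrightarrow>
        f x (y \<otimes>\<^bsub>H\<^esub> y') = f x y \<otimes>\<^bsub>H\<^esub> f (\<beta> y x) (y \<triangleright>\<^bsub>H\<^esub> y')"
    and bracket_mult_left:
      "\<lbrakk>x \<in> carrier G; x' \<in> carrier G; y \<in> carrier H\<rbrakk> \<Longrightarrow>
        f (x \<otimes>\<^bsub>G\<^esub> x') y = f (x \<triangleright>\<^bsub>G\<^esub> x') (\<alpha> x y) \<otimes>\<^bsub>H\<^esub> f x y"
    and bracket_star_left:
      "\<lbrakk>x \<in> carrier G; x' \<in> carrier G; y \<in> carrier H\<rbrakk> \<Longrightarrow>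
        f (x \<star>\<^bsub>G\<^esub> x') (\<alpha> x' y)
          \<otimes>\<^bsub>H\<^esub> inv\<^bsub>H\<^esub> (f (\<beta> y x) (f x' y))
          \<otimes>\<^bsub>H\<^esub> inv\<^bsub>H\<^esub> (f (x \<triangleright>\<^bsub>G\<^esub> x') (inv\<^bsub>H\<^esub> (f x y))) = \<one>\<^bsub>H\<^esub>"
    and bracket_star_right:
      "\<lbrakk>x \<in> carrier G; y \<in> carrier H; y' \<in> carrier H\<rbrakk> \<Longrightarrow>
        f (\<beta> y' x) (y \<star>\<^bsub>H\<^esub> y')
          \<otimes>\<^bsub>H\<^esub> inv\<^bsub>H\<^esub> (f (inv\<^bsub>G\<^esub> (k y x)) (y \<triangleright>\<^bsub>H\<^esub> y'))
          \<otimes>\<^bsub>H\<^esub> inv\<^bsub>H\<^esub> (f (k y' x) (\<alpha> x y)) = \<one>\<^bsub>H\<^esub>"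

locale mutual_lie_actions =
  GH: lie_action G H \<alpha> \<beta> f k + HG: lie_action H G \<beta> \<alpha> k f
  for G :: "('a, 'm) mult_lie_scheme" and H :: "('b, 'n) mult_lie_scheme"
    and \<alpha> :: "'a \<Rightarrow> 'b \<Rightarrow> 'b" and \<beta> :: "'b \<Rightarrow> 'a \<Rightarrow> 'a"
    and f :: "'a \<Rightarrow> 'b \<Rightarrow> 'b" and k :: "'b \<Rightarrow> 'a \<Rightarrow> 'a"

locale compatible_lie_actions = mutual_lie_actions +
  assumes compat_act_G:
      "\<lbrakk>g \<in> carrier G; g' \<in> carrier G; h \<in> carrier H\<rbrakk> \<Longrightarrow>
        \<beta> (\<alpha> g h) g' = g \<triangleright>\<^bsub>G\<^esub> (\<beta> h (inv\<^bsub>G\<^esub> g \<triangleright>\<^bsub>G\<^esub> g'))"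
    and compat_act_H:
      "\<lbrakk>g \<in> carrier G; h \<in> carrier H; h' \<in> carrier H\<rbrakk> \<Longrightarrow>
        \<alpha> (\<beta> h g) h' = h \<triangleright>\<^bsub>H\<^esub> (\<alpha> g (inv\<^bsub>H\<^esub> h \<triangleright>\<^bsub>H\<^esub> h'))"
    and compat_star_H:
      "\<lbrakk>g \<in> carrier G; h \<in> carrier H; h' \<in> carrier H\<rbrakk> \<Longrightarrow>
        f (inv\<^bsub>G\<^esub> (k h g)) h' = f g h \<star>\<^bsub>H\<^esub> h'"
    and compat_star_G:
      "\<lbrakk>g \<in> carrier G; g' \<in> carrier G; h \<in> carrier H\<rbrakk> \<Longrightarrow>
        k (inv\<^bsub>H\<^esub> (f g h)) g' = k h g \<star>\<^bsub>G\<^esub> g'"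
    and compat_trivial_H:
      "\<lbrakk>g \<in> carrier G; h \<in> carrier H; h' \<in> carrier H\<rbrakk> \<Longrightarrow>
        f g h \<triangleright>\<^bsub>H\<^esub> (\<alpha> (k h g) h') = h'"
    and compat_trivial_G:
      "\<lbrakk>g \<in> carrier G; g' \<in> carrier G; h \<in> carrier H\<rbrakk> \<Longrightarrow>
        \<beta> (f g h) (k h g \<triangleright>\<^bsub>G\<^esub> g') = g'"
    and compat_equivariant_G:
      "\<lbrakk>g \<in> carrier G; g' \<in> carrier G; h \<in> carrier H\<rbrakk> \<Longrightarrow>
        g \<triangleright>\<^bsub>G\<^esub> (k h g') = k (\<alpha> g h) (g \<triangleright>\<^bsub>G\<^esub> g')"
    and compat_equivariant_H:
      "\<lbrakk>g \<in> carrier G; h \<in> carrier H; h' \<in> carrier H\<rbrakk> \<Longrightarrow>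
        h \<triangleright>\<^bsub>H\<^esub> (f g h') = f (\<beta> h g) (h \<triangleright>\<^bsub>H\<^esub> h')"
    and compat_commutator_H:
      "\<lbrakk>g \<in> carrier G; h \<in> carrier H; h' \<in> carrier H\<rbrakk> \<Longrightarrow>
        f (g \<otimes>\<^bsub>G\<^esub> \<beta> h (inv\<^bsub>G\<^esub> g)) h' = (\<alpha> g h \<otimes>\<^bsub>H\<^esub> inv\<^bsub>H\<^esub> h) \<star>\<^bsub>H\<^esub> h'"
    and compat_commutator_G:
      "\<lbrakk>g \<in> carrier G; g' \<in> carrier G; h \<in> carrier H\<rbrakk> \<Longrightarrow>
        k (h \<otimes>\<^bsub>H\<^esub> \<alpha> g (inv\<^bsub>H\<^esub> h)) g' = (\<beta> h g \<otimes>\<^bsub>G\<^esub> inv\<^bsub>G\<^esub> g) \<star>\<^bsub>G\<^esub> g'"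

(* The subgroup \<langle>G,H\<rangle> of H. *)
definition bracket_subgroup ::
    "('a, 'm) mult_lie_scheme \<Rightarrow> ('b, 'n) mult_lie_scheme \<Rightarrow> ('a \<Rightarrow> 'b \<Rightarrow> 'b) \<Rightarrow> 'b set"
  where "bracket_subgroup G H f = generate H {f g h | g h. g \<in> carrier G \<and> h \<in> carrier H}"

(* The subgroup \<^sup>L[H,G] of G, generated by the elements inv \<langle>h,g\<rangle> (\<^sup>hg inv g). *)
definition lie_commutator_subgroup ::
    "('a, 'm) mult_lie_scheme \<Rightarrow> ('b, 'n) mult_lie_scheme \<Rightarrow>
     ('b \<Rightarrow> 'a \<Rightarrow> 'a) \<Rightarrow> ('b \<Rightarrow> 'a \<Rightarrow> 'a) \<Rightarrow> 'a set"
  where "lie_commutator_subgroup G H \<beta> k =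
    generate G {inv\<^bsub>G\<^esub> (k h g) \<otimes>\<^bsub>G\<^esub> (\<beta> h g \<otimes>\<^bsub>G\<^esub> inv\<^bsub>G\<^esub> g) | h g. h \<in> carrier H \<and> g \<in> carrier G}"


section \<open>Generators and relations\<close>

datatype 'g lie_word =
    Gen 'g
  | One
  | Inv "'g lie_word"
  | Mul "'g lie_word" "'g lie_word"
  | Star "'g lie_word" "'g lie_word"

definition lie_words :: "'g set \<Rightarrow> 'g lie_word set"
  where "lie_words X = {w. set_lie_word w \<subseteq> X}"

abbreviation Conj :: "'g lie_word \<Rightarrow> 'g lie_word \<Rightarrow> 'g lie_word"
  where "Conj z x \<equiv> Mul (Mul z x) (Inv z)"

(* The least congruence on the words over X that contains R and whose quotient
   satisfies the axioms of a multiplicative Lie algebra. *)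
inductive_set lie_cong ::
    "'g set \<Rightarrow> ('g lie_word \<times> 'g lie_word) set \<Rightarrow> ('g lie_word \<times> 'g lie_word) set"
  for X :: "'g set" and R :: "('g lie_word \<times> 'g lie_word) set"
where
  rel: "\<lbrakk>(u, v) \<in> R; u \<in> lie_words X; v \<in> lie_words X\<rbrakk> \<Longrightarrow> (u, v) \<in> lie_cong X R"
| refl: "u \<in> lie_words X \<Longrightarrow> (u, u) \<in> lie_cong X R"
| sym: "(u, v) \<in> lie_cong X R \<Longrightarrow> (v, u) \<in> lie_cong X R"
| trans: "\<lbrakk>(u, v) \<in> lie_cong X R; (v, w) \<in> lie_cong X R\<rbrakk> \<Longrightarrow> (u, w) \<in> lie_cong X R"
| Inv: "(u, v) \<in> lie_cong X R \<Longrightarrow> (Inv u, Inv v) \<in> lie_cong X R"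
| Mul: "\<lbrakk>(u, v) \<in> lie_cong X R; (u', v') \<in> lie_cong X R\<rbrakk> \<Longrightarrow>
    (Mul u u', Mul v v') \<in> lie_cong X R"
| Star: "\<lbrakk>(u, v) \<in> lie_cong X R; (u', v') \<in> lie_cong X R\<rbrakk> \<Longrightarrow>
    (Star u u', Star v v') \<in> lie_cong X R"
| assoc: "\<lbrakk>u \<in> lie_words X; v \<in> lie_words X; w \<in> lie_words X\<rbrakk> \<Longrightarrow>
    (Mul (Mul u v) w, Mul u (Mul v w)) \<in> lie_cong X R"
| l_one: "u \<in> lie_words X \<Longrightarrow> (Mul One u, u) \<in> lie_cong X R"
| l_inv: "u \<in> lie_words X \<Longrightarrow> (Mul (Inv u) u, One) \<in> lie_cong X R"
| star_self: "u \<in> lie_words X \<Longrightarrow> (Star u u, One) \<in> lie_cong X R"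
| star_mult_right: "\<lbrakk>u \<in> lie_words X; v \<in> lie_words X; w \<in> lie_words X\<rbrakk> \<Longrightarrow>
    (Star u (Mul v w), Mul (Star u v) (Conj v (Star u w))) \<in> lie_cong X R"
| star_mult_left: "\<lbrakk>u \<in> lie_words X; v \<in> lie_words X; w \<in> lie_words X\<rbrakk> \<Longrightarrow>
    (Star (Mul u v) w, Mul (Conj u (Star v w)) (Star u w)) \<in> lie_cong X R"
| star_jacobi: "\<lbrakk>u \<in> lie_words X; v \<in> lie_words X; w \<in> lie_words X\<rbrakk> \<Longrightarrow>
    (Mul (Mul (Star (Star u v) (Conj v w)) (Star (Star v w) (Conj w u)))
       (Star (Star w u) (Conj u v)), One) \<in> lie_cong X R"
| conj_star: "\<lbrakk>u \<in> lie_words X; v \<in> lie_words X; w \<in> lie_words X\<rbrakk> \<Longrightarrow>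
    (Conj w (Star u v), Star (Conj w u) (Conj w v)) \<in> lie_cong X R"

definition lie_presented ::
    "'g set \<Rightarrow> ('g lie_word \<times> 'g lie_word) set \<Rightarrow> 'g lie_word set mult_lie"
  where "lie_presented X R =
    \<lparr>carrier = lie_words X // lie_cong X R,
     monoid.mult = (\<lambda>A B. \<Union>u\<in>A. \<Union>v\<in>B. lie_cong X R `` {Mul u v}),
     one = lie_cong X R `` {One},
     star = (\<lambda>A B. \<Union>u\<in>A. \<Union>v\<in>B. lie_cong X R `` {Star u v})\<rparr>"

definition lie_presented_gen ::
    "'g set \<Rightarrow> ('g lie_word \<times> 'g lie_word) set \<Rightarrow> 'g \<Rightarrow> 'g lie_word set"
  where "lie_presented_gen X R x = lie_cong X R `` {Gen x}"


section \<open>The tensor product\<close>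

(* Gen (x, y) stands for the symbol x \<otimes> y. *)
inductive_set tensor_rels ::
    "('a, 'm) mult_lie_scheme \<Rightarrow> ('b, 'n) mult_lie_scheme \<Rightarrow>
     ('a \<Rightarrow> 'b \<Rightarrow> 'b) \<Rightarrow> ('b \<Rightarrow> 'a \<Rightarrow> 'a) \<Rightarrow> ('a \<Rightarrow> 'b \<Rightarrow> 'b) \<Rightarrow> ('b \<Rightarrow> 'a \<Rightarrow> 'a) \<Rightarrow>
     (('a \<times> 'b) lie_word \<times> ('a \<times> 'b) lie_word) set"
  for G :: "('a, 'm) mult_lie_scheme" and H :: "('b, 'n) mult_lie_scheme"
    and \<alpha> :: "'a \<Rightarrow> 'b \<Rightarrow> 'b" and \<beta> :: "'b \<Rightarrow> 'a \<Rightarrow> 'a"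
    and f :: "'a \<Rightarrow> 'b \<Rightarrow> 'b" and k :: "'b \<Rightarrow> 'a \<Rightarrow> 'a"
where
  mult_right: "\<lbrakk>x \<in> carrier G; y \<in> carrier H; y' \<in> carrier H\<rbrakk> \<Longrightarrow>
    (Gen (x, y \<otimes>\<^bsub>H\<^esub> y'), Mul (Gen (x, y)) (Gen (\<beta> y x, y \<triangleright>\<^bsub>H\<^esub> y')))
      \<in> tensor_rels G H \<alpha> \<beta> f k"
| mult_left: "\<lbrakk>x \<in> carrier G; x' \<in> carrier G; y \<in> carrier H\<rbrakk> \<Longrightarrow>
    (Gen (x \<otimes>\<^bsub>G\<^esub> x', y), Mul (Gen (x \<triangleright>\<^bsub>G\<^esub> x', \<alpha> x y)) (Gen (x, y)))
      \<in> tensor_rels G H \<alpha> \<beta> f k"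
| star_left: "\<lbrakk>x \<in> carrier G; x' \<in> carrier G; y \<in> carrier H\<rbrakk> \<Longrightarrow>
    (Mul (Mul (Gen (x \<star>\<^bsub>G\<^esub> x', \<alpha> x' y))
              (Inv (Gen (\<beta> y x, f x' y))))
         (Inv (Gen (x \<triangleright>\<^bsub>G\<^esub> x', inv\<^bsub>H\<^esub> (f x y)))),
     One) \<in> tensor_rels G H \<alpha> \<beta> f k"
| star_right: "\<lbrakk>x \<in> carrier G; y \<in> carrier H; y' \<in> carrier H\<rbrakk> \<Longrightarrow>
    (Mul (Mul (Gen (\<beta> y' x, y \<star>\<^bsub>H\<^esub> y'))
              (Inv (Gen (inv\<^bsub>G\<^esub> (k y x), y \<triangleright>\<^bsub>H\<^esub> y'))))
         (Inv (Gen (k y' x, \<alpha> x y))),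
     One) \<in> tensor_rels G H \<alpha> \<beta> f k"
| star: "\<lbrakk>x \<in> carrier G; x' \<in> carrier G; y \<in> carrier H; y' \<in> carrier H\<rbrakk> \<Longrightarrow>
    (Star (Gen (x, y)) (Gen (x', y')), Gen (inv\<^bsub>G\<^esub> (k y x), f x' y'))
      \<in> tensor_rels G H \<alpha> \<beta> f k"

definition lie_tensor ::
    "('a, 'm) mult_lie_scheme \<Rightarrow> ('b, 'n) mult_lie_scheme \<Rightarrow>
     ('a \<Rightarrow> 'b \<Rightarrow> 'b) \<Rightarrow> ('b \<Rightarrow> 'a \<Rightarrow> 'a) \<Rightarrow> ('a \<Rightarrow> 'b \<Rightarrow> 'b) \<Rightarrow> ('b \<Rightarrow> 'a \<Rightarrow> 'a) \<Rightarrow>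
     ('a \<times> 'b) lie_word set mult_lie"
  where "lie_tensor G H \<alpha> \<beta> f k =
    lie_presented (carrier G \<times> carrier H) (tensor_rels G H \<alpha> \<beta> f k)"

definition pure_tensor ::
    "('a, 'm) mult_lie_scheme \<Rightarrow> ('b, 'n) mult_lie_scheme \<Rightarrow>
     ('a \<Rightarrow> 'b \<Rightarrow> 'b) \<Rightarrow> ('b \<Rightarrow> 'a \<Rightarrow> 'a) \<Rightarrow> ('a \<Rightarrow> 'b \<Rightarrow> 'b) \<Rightarrow> ('b \<Rightarrow> 'a \<Rightarrow> 'a) \<Rightarrow>
     'a \<Rightarrow> 'b \<Rightarrow> ('a \<times> 'b) lie_word set"
  where "pure_tensor G H \<alpha> \<beta> f k x y =
    lie_presented_gen (carrier G \<times> carrier H) (tensor_rels G H \<alpha> \<beta> f k) (x, y)"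

definition tensor_subgroup ::
    "('a, 'm) mult_lie_scheme \<Rightarrow> ('b, 'n) mult_lie_scheme \<Rightarrow>
     ('a \<Rightarrow> 'b \<Rightarrow> 'b) \<Rightarrow> ('b \<Rightarrow> 'a \<Rightarrow> 'a) \<Rightarrow> ('a \<Rightarrow> 'b \<Rightarrow> 'b) \<Rightarrow> ('b \<Rightarrow> 'a \<Rightarrow> 'a) \<Rightarrow>
     'a set \<Rightarrow> 'b set \<Rightarrow> ('a \<times> 'b) lie_word set set"
  where "tensor_subgroup G H \<alpha> \<beta> f k I J =
    generate (lie_tensor G H \<alpha> \<beta> f k) {pure_tensor G H \<alpha> \<beta> f k a b | a b. a \<in> I \<and> b \<in> J}"

end

theory Submission
  imports Defs
begin

text \<open>Let \<open>N\<close> be the ideal in question. The pure tensors generate \<open>G \<otimes> H\<close> as a group and, as for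
  Brown and Loday's tensor product of groups, the commutator of \<open>x \<otimes> y\<close> and \<open>x' \<otimes> y'\<close> is
  \<open>g \<otimes> h'\<close>, where \<open>g = comm_G x y\<close> and \<open>h' = comm_H x' y'\<close>. Let \<open>a\<close> be the inverse of \<open>\<langle>y, x\<rangle>\<close>
  and \<open>b = \<langle>x', y'\<rangle>\<close>, so that the star of the two tensors is \<open>a \<otimes> b\<close>. Modulo \<open>N\<close> one has
  \<open>g \<otimes> b = a \<otimes> b\<close>; writing \<open>h' = b \<cdot> m\<close> and expanding \<open>g \<otimes> b \<cdot> m\<close>, the Lie commutator of the two
  tensors is therefore the conjugate of \<open>g \<otimes> m\<close> by \<open>b\<close>.

  By compatibility \<open>g\<close> acts on \<open>H\<close> and pairs with it exactly as some element \<open>d\<close> of \<open>H\<close> does.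
  If \<open>x'\<close> is already of this kind then \<open>m\<close> is the Lie commutator of \<open>d\<close> and \<open>y'\<close> in \<open>H\<close>. So
  every Lie commutator after the first one moves the right factor one step down the lower central
  series of \<open>H\<close>, which accounts for the class \<open>n + 1\<close>.\<close>

section \<open>Ideals and quotients\<close>

context group
begin

lemma inv_mult_cancel [simp]:
  "\<lbrakk>x \<in> carrier G; y \<in> carrier G\<rbrakk> \<Longrightarrow> inv x \<otimes> (x \<otimes> y) = y"
  "\<lbrakk>x \<in> carrier G; y \<in> carrier G\<rbrakk> \<Longrightarrow> x \<otimes> (inv x \<otimes> y) = y"
  by (simp_all add: m_assoc[symmetric])

lemma conjugate_closed [intro, simp]:
  "\<lbrakk>z \<in> carrier G; x \<in> carrier G\<rbrakk> \<Longrightarrow> z \<triangleright> x \<in> carrier G"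
  by (simp add: conjugate_def)

lemma conjugate_one [simp]: "z \<in> carrier G \<Longrightarrow> z \<triangleright> \<one> = \<one>"
  by (simp add: conjugate_def)

lemma one_conjugate [simp]: "x \<in> carrier G \<Longrightarrow> \<one> \<triangleright> x = x"
  by (simp add: conjugate_def)

lemma conjugate_mult:
  "\<lbrakk>z \<in> carrier G; x \<in> carrier G; y \<in> carrier G\<rbrakk> \<Longrightarrow> z \<triangleright> (x \<otimes> y) = (z \<triangleright> x) \<otimes> (z \<triangleright> y)"
  by (simp add: conjugate_def m_assoc)

lemma mult_conjugate:
  "\<lbrakk>z \<in> carrier G; w \<in> carrier G; x \<in> carrier G\<rbrakk> \<Longrightarrow> (z \<otimes> w) \<triangleright> x = z \<triangleright> w \<triangleright> x"
  by (simp add: conjugate_def m_assoc inv_mult_group)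

lemma conjugate_inv:
  "\<lbrakk>z \<in> carrier G; x \<in> carrier G\<rbrakk> \<Longrightarrow> z \<triangleright> inv x = inv (z \<triangleright> x)"
  by (simp add: conjugate_def m_assoc inv_mult_group)

lemma conjugate_cancel [simp]:
  "\<lbrakk>z \<in> carrier G; x \<in> carrier G\<rbrakk> \<Longrightarrow> inv z \<triangleright> z \<triangleright> x = x"
  "\<lbrakk>z \<in> carrier G; x \<in> carrier G\<rbrakk> \<Longrightarrow> z \<triangleright> inv z \<triangleright> x = x"
  by (simp_all add: mult_conjugate[symmetric])

lemma commutator_closed [intro, simp]:
  "\<lbrakk>x \<in> carrier G; y \<in> carrier G\<rbrakk> \<Longrightarrow> commutator G x y \<in> carrier G"
  by (simp add: commutator_def)

lemma normal_conjugate_closed: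
  "\<lbrakk>N \<lhd> G; z \<in> carrier G; x \<in> N\<rbrakk> \<Longrightarrow> z \<triangleright> x \<in> N"
  by (simp add: conjugate_def normal.inv_op_closed2)

text \<open>Conjugation by a fixed element is a homomorphism, so it can be tested on
  \<open>S\<close>; conjugations compose, so the conjugating element can be taken from
  \<open>P\<close>. Both \<open>u\<close> and \<open>inv u\<close> occur because a conjugation
  mapping a subgroup into itself need not map it onto itself.\<close>

lemma normal_generate_conjugateI:
  assumes P: "P \<subseteq> carrier G" "carrier G = generate G P" and S: "S \<subseteq> carrier G"
    and conj: "\<And>u s. \<lbrakk>u \<in> P; s \<in> S\<rbrakk> \<Longrightarrow> u \<triangleright> s \<in> generate G S \<and> inv u \<triangleright> s \<in> generate G S"
  shows "generate G S \<lhd> G"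
proof -
  let ?N = "generate G S"
  interpret N: subgroup ?N G by (rule generate_is_subgroup[OF S])
  have step: "z \<triangleright> x \<in> ?N"
    if "z \<in> carrier G" "\<And>s. s \<in> S \<Longrightarrow> z \<triangleright> s \<in> ?N" "x \<in> ?N" for z x
    using that(3)
  proof (induction rule: generate.induct)
    case (eng a b)
    then show ?case using that(1) by (simp add: conjugate_mult)
  qed (use that S in \<open>auto simp: conjugate_inv subset_iff\<close>)
  have "z \<triangleright> x \<in> ?N" if "z \<in> generate G P" "x \<in> ?N" for z x
    using that
  proof (induction arbitrary: x rule: generate.induct)
    case one
    then show ?case by simp
  next
    case (incl h)
    then show ?case using conj P step[of h] by blast
  next
    case (inv h)
    then show ?case using conj P step[of "inv h"] by (meson inv_closed subsetD)
  next
    case (eng a b)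
    then have "a \<in> carrier G" "b \<in> carrier G" using P by auto
    with eng show ?case by (simp add: mult_conjugate)
  qed
  then show ?thesis
    using P by (simp add: normal_inv_iff N.subgroup_axioms conjugate_def)
qed

end

section \<open>The star operation: expansion laws, and extension from generators\<close>

context mult_lie_algebra
begin

lemma star_one_right [simp]: "x \<in> carrier K \<Longrightarrow> x \<star> \<one> = \<one>"
  using star_mult_right[of x \<one> \<one>] by (simp add: r_cancel_one')

lemma star_one_left [simp]: "x \<in> carrier K \<Longrightarrow> \<one> \<star> x = \<one>"
  using star_mult_left[of \<one> \<one> x] by (simp add: r_cancel_one')

lemma star_inv_right:
  assumes "x \<in> carrier K" "y \<in> carrier K"
  shows "x \<star> inv y = inv y \<triangleright> inv (x \<star> y)"
proof -
  have "(x \<star> inv y) \<otimes> (inv y \<triangleright> (x \<star> y)) = \<one>"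
    using assms star_mult_right[of x "inv y" y] by simp
  then show ?thesis
    using assms by (simp add: conjugate_inv inv_equality[symmetric])
qed

lemma star_inv_left:
  assumes "x \<in> carrier K" "y \<in> carrier K"
  shows "inv x \<star> y = inv x \<triangleright> inv (x \<star> y)"
proof -
  have "(inv x \<triangleright> (x \<star> y)) \<otimes> (inv x \<star> y) = \<one>"
    using assms star_mult_left[of "inv x" x y] by simp
  then show ?thesis
    using assms by (metis conjugate_closed conjugate_inv inv_closed inv_comm inv_equality star_closed)
qed

text \<open>Expanding the star of \<open>x \<otimes> y\<close> with itself, which is
  \<open>\<one>\<close>, in both arguments leaves a conjugate of
  \<open>(y \<star> x) \<otimes> (x \<star> y)\<close>.\<close>

lemma star_antisym:
  assumes "x \<in> carrier K" "y \<in> carrier K"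
  shows "x \<star> y = inv (y \<star> x)"
proof -
  have 1: "(x \<otimes> y) \<star> x = x \<triangleright> (y \<star> x)" "(x \<otimes> y) \<star> y = x \<star> y"
    using assms by (simp_all add: star_mult_left star_self)
  have "\<one> = (x \<otimes> y) \<star> (x \<otimes> y)"
    using assms by (simp add: star_self)
  also have "\<dots> = (x \<triangleright> (y \<star> x)) \<otimes> (x \<triangleright> (x \<star> y))"
    using assms by (subst star_mult_right) (simp_all add: 1)
  also have "\<dots> = x \<triangleright> ((y \<star> x) \<otimes> (x \<star> y))"
    using assms by (simp add: conjugate_mult)
  finally have "inv x \<triangleright> \<one> = (y \<star> x) \<otimes> (x \<star> y)"
    using assms by simp
  then show ?thesis
    using assms by (metis conjugate_one inv_closed inv_comm inv_equality star_closed)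
qed

lemma lie_commutator_closed [intro, simp]:
  "\<lbrakk>x \<in> carrier K; y \<in> carrier K\<rbrakk> \<Longrightarrow> lie_commutator K x y \<in> carrier K"
  by (simp add: lie_commutator_def)

text \<open>The star and the commutator satisfy the same expansion laws, so they agree as soon as
  they agree on generators.\<close>

lemma star_eq_commutator_generate:
  assumes P: "P \<subseteq> carrier K" and S: "S \<subseteq> carrier K"
    and eq: "\<And>u v. \<lbrakk>u \<in> P; v \<in> S\<rbrakk> \<Longrightarrow> u \<star> v = commutator K u v"
    and u: "u \<in> generate K P" and v: "v \<in> generate K S"
  shows "u \<star> v = commutator K u v"
proof -
  have comm_mult_right: "commutator K x (y \<otimes> z) = commutator K x y \<otimes> (y \<triangleright> commutator K x z)"
    and comm_mult_left: "commutator K (x \<otimes> y) z = (x \<triangleright> commutator K y z) \<otimes> commutator K x z"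
    if "x \<in> carrier K" "y \<in> carrier K" "z \<in> carrier K" for x y z
    using that by (simp_all add: commutator_def conjugate_def m_assoc inv_mult_group)
  have right: "u \<star> v = commutator K u v" if u: "u \<in> P" for u
    using v
  proof (induction rule: generate.induct)
    case one
    then show ?case using u P by (auto simp: commutator_def subset_iff)
  next
    case (incl h)
    then show ?case using u eq by simp
  next
    case (inv h)
    then show ?case using u P S eq[OF u inv]
      by (simp add: star_inv_right commutator_def conjugate_def inv_mult_group m_assoc subset_iff)
  next
    case (eng a b)
    moreover have "a \<in> carrier K" "b \<in> carrier K" "u \<in> carrier K"
      using eng u P generate_incl[OF S] by auto
    ultimately show ?case by (simp add: star_mult_right comm_mult_right)
  qed
  have vK: "v \<in> carrier K" using v generate_incl[OF S] by auto
  show ?thesis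
    using u
  proof (induction rule: generate.induct)
    case one
    then show ?case using vK by (auto simp: commutator_def)
  next
    case (incl h)
    then show ?case using right by simp
  next
    case (inv h)
    then show ?case using vK P right[OF inv]
      by (simp add: star_inv_left commutator_def conjugate_def inv_mult_group m_assoc subset_iff)
  next
    case (eng a b)
    moreover have "a \<in> carrier K" "b \<in> carrier K"
      using eng generate_incl[OF P] by auto
    ultimately show ?case using vK by (simp add: star_mult_left comm_mult_left)
  qed
qed

text \<open>Expanding a star of products or inverses yields only stars conjugated by elements of the
  subgroup itself. This is what lets pure tensors generate the tensor product already as a
  group.\<close>

lemma star_in_generate:
  assumes P: "P \<subseteq> carrier K"
    and closed: "\<And>u v. \<lbrakk>u \<in> P; v \<in> P\<rbrakk> \<Longrightarrow> u \<star> v \<in> generate K P"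
    and u: "u \<in> generate K P" and v: "v \<in> generate K P"
  shows "u \<star> v \<in> generate K P"
proof -
  let ?N = "generate K P"
  interpret N: subgroup ?N K by (rule generate_is_subgroup[OF P])
  have conj: "x \<triangleright> y \<in> ?N" if "x \<in> ?N" "y \<in> ?N" for x y
    using that by (simp add: conjugate_def)
  have right: "u \<star> v \<in> ?N" if u: "u \<in> P" for u
    using v
  proof (induction rule: generate.induct)
    case (inv h)
    then show ?case using u P closed[OF u inv] conj[of "inv h" "inv (u \<star> h)"]
      by (simp add: star_inv_right subset_iff generate.inv)
  next
    case (eng a b)
    then show ?case using u P by (simp add: star_mult_right conj subset_iff)
  qed (use u P closed in \<open>auto simp: subset_iff\<close>)
  have vK: "v \<in> carrier K" using v by simp
  show ?thesis
    using u
  proof (induction rule: generate.induct)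
    case (inv h)
    then show ?case using vK P right[OF inv] conj[of "inv h" "inv (h \<star> v)"]
      by (simp add: star_inv_left subset_iff generate.inv)
  next
    case (eng a b)
    then show ?case using vK by (simp add: star_mult_left conj)
  qed (use vK right in auto)
qed

text \<open>The criterion by which ideals of the tensor product are recognised. Normality is settled
  first, because expanding the star of a product introduces conjugates.\<close>

lemma lie_ideal_generateI:
  assumes P: "P \<subseteq> carrier K" "carrier K = generate K P" and S: "S \<subseteq> carrier K"
    and conj: "\<And>u s. \<lbrakk>u \<in> P; s \<in> S\<rbrakk> \<Longrightarrow> u \<triangleright> s \<in> generate K S \<and> inv u \<triangleright> s \<in> generate K S"
    and star: "\<And>u s. \<lbrakk>u \<in> P; s \<in> S\<rbrakk> \<Longrightarrow> u \<star> s \<in> generate K S"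
  shows "lie_ideal (generate K S) K"
proof -
  let ?N = "generate K S"
  have N: "?N \<lhd> K" by (rule normal_generate_conjugateI[OF P S conj])
  interpret N: subgroup ?N K by (rule generate_is_subgroup[OF S])
  note conjN = normal_conjugate_closed[OF N]
  have right: "u \<star> v \<in> ?N" if u: "u \<in> P" and v: "v \<in> ?N" for u v
    using v
  proof (induction rule: generate.induct)
    case (inv h)
    then show ?case using u P(1) S star[OF u inv]
      by (auto simp: star_inv_right subset_iff intro!: conjN)
  next
    case (eng a b)
    then show ?case using u P(1) by (simp add: star_mult_right conjN subset_iff)
  qed (use u P star in \<open>auto simp: subset_iff\<close>)
  have "u \<star> v \<in> ?N" if u: "u \<in> generate K P" and v: "v \<in> ?N" for u v
    using u
  proof (induction rule: generate.induct)
    case (inv h)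
    then show ?case using v P(1) right[OF inv v]
      by (auto simp: star_inv_left subset_iff intro!: conjN)
  next
    case (eng a b)
    moreover have "a \<in> carrier K" "b \<in> carrier K"
      using eng P(2) by simp_all
    ultimately show ?case using v by (simp add: star_mult_left conjN)
  qed (use v right in auto)
  with N P(2) show ?thesis by (simp add: lie_ideal_def)
qed

lemma carrier_lie_ideal: "lie_ideal (carrier K) K"
  by (simp add: lie_ideal_def normal_self)

lemma lie_ideal_lie_ideal_generated:
  assumes "S \<subseteq> carrier K"
  shows "lie_ideal (lie_ideal_generated K S) K"
proof -
  let ?F = "{I. lie_ideal I K \<and> S \<subseteq> I}"
  \<comment> \<open>The carrier belongs to the family; the intersection of an empty family would be
    \<open>UNIV\<close>.\<close>
  have ne: "?F \<noteq> {}" using assms carrier_lie_ideal by auto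
  have sub: "subgroup I K" if "I \<in> ?F" for I
    using that by (simp add: lie_ideal_def normal_imp_subgroup)
  have "subgroup (\<Inter>?F) K"
    using sub ne by (intro subgroups_Inter) auto
  then have "\<Inter>?F \<lhd> K"
    unfolding normal_inv_iff by (auto simp: lie_ideal_def normal_inv_iff)
  then show ?thesis
    by (auto simp: lie_ideal_generated_def lie_ideal_def)
qed

lemma lie_ideal_lower_central: "lie_ideal (lie_lower_central K j) K"
proof (induction j)
  case (Suc j)
  then have "lie_lower_central K j \<subseteq> carrier K"
    by (simp add: lie_ideal_def normal_imp_subgroup subgroup.subset)
  then show ?case
    by (auto intro!: lie_ideal_lie_ideal_generated)
qed (simp add: carrier_lie_ideal)

lemma lie_commutator_in_lower_central:
  "\<lbrakk>a \<in> carrier K; b \<in> lie_lower_central K j\<rbrakk> \<Longrightarrow>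
    lie_commutator K a b \<in> lie_lower_central K (Suc j)"
  by (auto simp: lie_ideal_generated_def)

lemma lower_central_Suc_subset:
  assumes "lie_ideal I K"
    and "\<And>a b. \<lbrakk>a \<in> carrier K; b \<in> lie_lower_central K j\<rbrakk> \<Longrightarrow> lie_commutator K a b \<in> I"
  shows "lie_lower_central K (Suc j) \<subseteq> I"
  using assms by (auto simp: lie_ideal_generated_def)

end

section \<open>The quotient by an ideal\<close>

locale lie_ideal_quotient = mult_lie_algebra K for K (structure) +
  fixes I assumes ideal: "lie_ideal I K"
begin

abbreviation Q where "Q \<equiv> lie_quotient K I"
abbreviation q where "q a \<equiv> I #> a"

lemma normal: "I \<lhd> K"
  using ideal by (simp add: lie_ideal_def)

sublocale I: normal I K by (rule normal)

lemma quotient_carrier: "carrier Q = q ` carrier K"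
  by (simp add: lie_quotient_def carrier_FactGroup)

lemma quotient_group: "group Q"
proof -
  interpret F: group "K Mod I" by (rule I.factorgroup_is_group)
  show ?thesis
    by (rule groupI)
      (use F.m_closed F.one_closed F.m_assoc F.l_one F.l_inv_ex in \<open>simp_all add: lie_quotient_def\<close>)
qed

sublocale quotient: group_hom K Q q
proof (rule group_hom.intro)
  show "group_hom_axioms K Q q"
    using I.r_coset_hom_Mod by (simp add: group_hom_axioms_def hom_def lie_quotient_def)
qed (use is_group quotient_group in auto)

text \<open>For right cosets the criterion is naturally about \<open>b \<otimes> inv a\<close>;
  normality turns it into the form \<open>inv a \<otimes> b\<close>, which is the shape of
  \<open>lie_commutator\<close>.\<close>

lemma coset_eq_iff:
  assumes "a \<in> carrier K" "b \<in> carrier K"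
  shows "q a = q b \<longleftrightarrow> inv a \<otimes> b \<in> I"
proof -
  have "q a = q b \<longleftrightarrow> b \<otimes> inv a \<in> I"
    using assms by (metis I.rcos_module I.subgroup_axioms is_group rcos_self repr_independence)
  also have "\<dots> \<longleftrightarrow> inv a \<otimes> b \<in> I"
    using assms by (metis I.inv_op_closed1 I.inv_op_closed2 I.mem_carrier inv_closed inv_mult_cancel
        m_assoc m_closed r_inv r_one l_inv)
  finally show ?thesis .
qed

lemma coset_in [simp]: "a \<in> I \<Longrightarrow> q a = \<one>\<^bsub>Q\<^esub>"
  by (simp add: I.rcos_const lie_quotient_def)

lemma coset_conjugate:
  "\<lbrakk>a \<in> carrier K; b \<in> carrier K\<rbrakk> \<Longrightarrow> q (a \<triangleright> b) = q a \<triangleright>\<^bsub>Q\<^esub> q b"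
  by (simp add: conjugate_def)

text \<open>Replacing a representative \<open>a\<close> by \<open>i \<otimes> a\<close> with
  \<open>i\<close> in \<open>I\<close> changes a star only by factors that become trivial in the
  quotient, so the union in \<open>lie_quotient\<close> collapses to one coset.\<close>

lemma coset_star:
  assumes a: "a \<in> carrier K" and b: "b \<in> carrier K"
  shows "q a \<star>\<^bsub>Q\<^esub> q b = q (a \<star> b)"
proof -
  \<comment> \<open>The definition of an ideal has the element of \<open>I\<close> on the right of
    the star; antisymmetry supplies the other side.\<close>
  have starI: "z \<star> i \<in> I" "i \<star> z \<in> I" if "i \<in> I" "z \<in> carrier K" for i z
    using that ideal star_antisym[of i z] by (auto simp: lie_ideal_def)
  have "q ((i \<otimes> a) \<star> (j \<otimes> b)) = q (a \<star> b)" if i: "i \<in> I" and j: "j \<in> I" for i j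
  proof -
    have K: "i \<in> carrier K" "j \<in> carrier K" using i j by auto
    have "q ((i \<otimes> a) \<star> (j \<otimes> b)) = q (a \<star> (j \<otimes> b))"
      using a b i K starI[OF i, of "j \<otimes> b"]
      by (simp add: star_mult_left coset_conjugate)
    also have "\<dots> = q (a \<star> b)"
      using a b j K starI[OF j, of a]
      by (simp add: star_mult_right coset_conjugate)
    finally show ?thesis .
  qed
  moreover have "\<exists>i\<in>I. x = i \<otimes> c" if "x \<in> q c" for x c
    using that by (auto simp: r_coset_def)
  ultimately have eq: "q (x \<star> y) = q (a \<star> b)" if "x \<in> q a" "y \<in> q b" for x y
    using that by metis
  \<comment> \<open>Both cosets are non-empty, so a union of one constant value over them is that
    value.\<close>
  have mem: "a \<in> q a" "b \<in> q b"
    using a b by (simp_all add: rcos_self I.subgroup_axioms)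
  have "(\<Union>x\<in>q a. \<Union>y\<in>q b. q (x \<star> y)) = (\<Union>x\<in>q a. \<Union>y\<in>q b. q (a \<star> b))"
    by (intro SUP_cong HOL.refl) (rule eq)
  also have "\<dots> = q (a \<star> b)"
    using mem by blast
  finally have "(\<Union>x\<in>q a. \<Union>y\<in>q b. q (x \<star> y)) = q (a \<star> b)" .
  then show ?thesis by (simp add: lie_quotient_def)
qed

sublocale quotient: mult_lie_algebra Q
proof
  fix A B C assume "A \<in> carrier Q" "B \<in> carrier Q" "C \<in> carrier Q"
  then obtain a b c where [simp]: "A = q a" "B = q b" "C = q c"
    and abc: "a \<in> carrier K" "b \<in> carrier K" "c \<in> carrier K"
    unfolding quotient_carrier by blast
  note simps = coset_star coset_conjugate[symmetric] quotient.hom_mult[symmetric]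
  show "A \<star>\<^bsub>Q\<^esub> B \<in> carrier Q"
    using abc by (simp add: coset_star)
  show "A \<star>\<^bsub>Q\<^esub> A = \<one>\<^bsub>Q\<^esub>"
    using abc by (simp add: coset_star star_self)
  show "A \<star>\<^bsub>Q\<^esub> (B \<otimes>\<^bsub>Q\<^esub> C) = (A \<star>\<^bsub>Q\<^esub> B) \<otimes>\<^bsub>Q\<^esub> (B \<triangleright>\<^bsub>Q\<^esub> (A \<star>\<^bsub>Q\<^esub> C))"
    using abc by (simp add: simps star_mult_right del: quotient.hom_mult)
  show "(A \<otimes>\<^bsub>Q\<^esub> B) \<star>\<^bsub>Q\<^esub> C = (A \<triangleright>\<^bsub>Q\<^esub> (B \<star>\<^bsub>Q\<^esub> C)) \<otimes>\<^bsub>Q\<^esub> (A \<star>\<^bsub>Q\<^esub> C)"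
    using abc by (simp add: simps star_mult_left del: quotient.hom_mult)
  show "((A \<star>\<^bsub>Q\<^esub> B) \<star>\<^bsub>Q\<^esub> (B \<triangleright>\<^bsub>Q\<^esub> C)) \<otimes>\<^bsub>Q\<^esub> ((B \<star>\<^bsub>Q\<^esub> C) \<star>\<^bsub>Q\<^esub> (C \<triangleright>\<^bsub>Q\<^esub> A))
      \<otimes>\<^bsub>Q\<^esub> ((C \<star>\<^bsub>Q\<^esub> A) \<star>\<^bsub>Q\<^esub> (A \<triangleright>\<^bsub>Q\<^esub> B)) = \<one>\<^bsub>Q\<^esub>"
    using abc by (simp add: simps star_jacobi del: quotient.hom_mult)
  show "C \<triangleright>\<^bsub>Q\<^esub> (A \<star>\<^bsub>Q\<^esub> B) = (C \<triangleright>\<^bsub>Q\<^esub> A) \<star>\<^bsub>Q\<^esub> (C \<triangleright>\<^bsub>Q\<^esub> B)"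
    using abc by (simp add: simps conjugate_star del: quotient.hom_mult)
qed

text \<open>A Lie commutator lies in \<open>I\<close> exactly when star and commutator agree on the
  two cosets. Agreement in the quotient extends from generators by
  \<open>star_eq_commutator_generate\<close>.\<close>

lemma lie_commutator_generate:
  assumes P: "P \<subseteq> carrier K" and S: "S \<subseteq> carrier K"
    and comm: "\<And>u v. \<lbrakk>u \<in> P; v \<in> S\<rbrakk> \<Longrightarrow> lie_commutator K u v \<in> I"
    and u: "u \<in> generate K P" and v: "v \<in> generate K S"
  shows "lie_commutator K u v \<in> I"
proof -
  have iff: "lie_commutator K u v \<in> I \<longleftrightarrow> q u \<star>\<^bsub>Q\<^esub> q v = commutator Q (q u) (q v)"
    if "u \<in> carrier K" "v \<in> carrier K" for u v
  proof -
    have "commutator Q (q u) (q v) = q (commutator K u v)"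
      using that by (simp add: commutator_def)
    then show ?thesis
      using that by (simp add: lie_commutator_def coset_eq_iff[symmetric] coset_star)
  qed
  have "q u \<star>\<^bsub>Q\<^esub> q v = commutator Q (q u) (q v)"
  proof (rule quotient.star_eq_commutator_generate)
    show "q u \<in> generate Q (q ` P)" "q v \<in> generate Q (q ` S)"
      using u v quotient.generate_img[OF P] quotient.generate_img[OF S] by blast+
    fix x y assume "x \<in> q ` P" "y \<in> q ` S"
    then show "x \<star>\<^bsub>Q\<^esub> y = commutator Q x y"
      using P S comm iff by blast
  qed (use P S in auto)
  then show ?thesis
    using iff u v generate_incl[OF P] generate_incl[OF S] by blast
qed

end


section \<open>Presented algebras\<close>

lemma lie_words_simps [simp]:
  "Gen x \<in> lie_words X \<longleftrightarrow> x \<in> X"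
  "One \<in> lie_words X"
  "Inv u \<in> lie_words X \<longleftrightarrow> u \<in> lie_words X"
  "Mul u v \<in> lie_words X \<longleftrightarrow> u \<in> lie_words X \<and> v \<in> lie_words X"
  "Star u v \<in> lie_words X \<longleftrightarrow> u \<in> lie_words X \<and> v \<in> lie_words X"
  by (auto simp: lie_words_def)

context
  fixes X :: "'g set" and R :: "('g lie_word \<times> 'g lie_word) set"
begin

abbreviation (input) word_class :: "'g lie_word \<Rightarrow> 'g lie_word set"
  where "word_class u \<equiv> lie_cong X R `` {u}"

abbreviation (input) F where "F \<equiv> lie_presented X R"

lemma lie_cong_words: "(u, v) \<in> lie_cong X R \<Longrightarrow> u \<in> lie_words X \<and> v \<in> lie_words X"
  by (induction rule: lie_cong.induct) auto

lemma equiv_lie_cong: "equiv (lie_words X) (lie_cong X R)"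
  by (rule equivI)
    (auto simp: refl_on_def sym_def trans_def dest: lie_cong_words intro: lie_cong.intros)

lemma lie_class_eq: "(u, v) \<in> lie_cong X R \<Longrightarrow> word_class u = word_class v"
  by (rule equiv_class_eq[OF equiv_lie_cong])

lemma presented_carrier: "carrier F = word_class ` lie_words X"
  by (auto simp: lie_presented_def quotient_def)

lemma presented_mult:
  assumes "u \<in> lie_words X" "v \<in> lie_words X"
  shows "word_class u \<otimes>\<^bsub>F\<^esub> word_class v = word_class (Mul u v)"
proof -
  have "congruent2 (lie_cong X R) (lie_cong X R) (\<lambda>u v. word_class (Mul u v))"
    by (auto simp: congruent2_def intro!: lie_class_eq lie_cong.Mul)
  from UN_equiv_class2[OF equiv_lie_cong equiv_lie_cong this assms]
  show ?thesis by (simp add: lie_presented_def)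
qed

lemma presented_star:
  assumes "u \<in> lie_words X" "v \<in> lie_words X"
  shows "word_class u \<star>\<^bsub>F\<^esub> word_class v = word_class (Star u v)"
proof -
  have "congruent2 (lie_cong X R) (lie_cong X R) (\<lambda>u v. word_class (Star u v))"
    by (auto simp: congruent2_def intro!: lie_class_eq lie_cong.Star)
  from UN_equiv_class2[OF equiv_lie_cong equiv_lie_cong this assms]
  show ?thesis by (simp add: lie_presented_def)
qed

lemma presented_one: "\<one>\<^bsub>F\<^esub> = word_class One"
  by (simp add: lie_presented_def)

lemma group_presented: "group F"
proof (rule groupI)
  fix A assume "A \<in> carrier F"
  then obtain u where u: "A = word_class u" "u \<in> lie_words X"
    by (auto simp: presented_carrier)
  then show "\<one>\<^bsub>F\<^esub> \<otimes>\<^bsub>F\<^esub> A = A"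
    by (simp add: presented_one presented_mult lie_class_eq[OF lie_cong.l_one])
  from u have "word_class (Inv u) \<otimes>\<^bsub>F\<^esub> A = \<one>\<^bsub>F\<^esub>"
    by (simp add: presented_one presented_mult lie_class_eq[OF lie_cong.l_inv])
  with u show "\<exists>B\<in>carrier F. B \<otimes>\<^bsub>F\<^esub> A = \<one>\<^bsub>F\<^esub>"
    by (auto simp: presented_carrier)
  fix B assume "B \<in> carrier F"
  then obtain v where v: "B = word_class v" "v \<in> lie_words X"
    by (auto simp: presented_carrier)
  with u show "A \<otimes>\<^bsub>F\<^esub> B \<in> carrier F"
    by (simp add: presented_mult) (simp add: presented_carrier)
  fix C assume "C \<in> carrier F"
  then obtain w where "C = word_class w" "w \<in> lie_words X"
    by (auto simp: presented_carrier)
  with u v show "A \<otimes>\<^bsub>F\<^esub> B \<otimes>\<^bsub>F\<^esub> C = A \<otimes>\<^bsub>F\<^esub> (B \<otimes>\<^bsub>F\<^esub> C)"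
    by (simp add: presented_mult lie_class_eq[OF lie_cong.assoc])
qed (simp add: presented_carrier presented_one)

lemma presented_inv:
  assumes "u \<in> lie_words X"
  shows "inv\<^bsub>F\<^esub> (word_class u) = word_class (Inv u)"
proof -
  interpret F: group F by (rule group_presented)
  show ?thesis
  proof (rule F.inv_equality)
    show "word_class (Inv u) \<otimes>\<^bsub>F\<^esub> word_class u = \<one>\<^bsub>F\<^esub>"
      using assms by (simp add: presented_one presented_mult lie_class_eq[OF lie_cong.l_inv])
  qed (use assms in \<open>simp_all add: presented_carrier\<close>)
qed

lemma mult_lie_algebra_presented: "mult_lie_algebra F"
proof -
  interpret F: group F by (rule group_presented)
  note simps = presented_mult presented_star presented_inv conjugate_def presented_one
  show ?thesis
  proof
    fix A B C assume "A \<in> carrier F" "B \<in> carrier F" "C \<in> carrier F"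
    then obtain a b c where eq: "A = word_class a" "B = word_class b" "C = word_class c"
      and abc: "a \<in> lie_words X" "b \<in> lie_words X" "c \<in> lie_words X"
      by (auto simp: presented_carrier)
    show "A \<star>\<^bsub>F\<^esub> B \<in> carrier F"
      using abc by (simp add: eq presented_star) (simp add: presented_carrier)
    show "A \<star>\<^bsub>F\<^esub> A = \<one>\<^bsub>F\<^esub>"
      using abc lie_class_eq[OF lie_cong.star_self[OF abc(1)]] by (simp add: eq simps)
    show "A \<star>\<^bsub>F\<^esub> (B \<otimes>\<^bsub>F\<^esub> C) = (A \<star>\<^bsub>F\<^esub> B) \<otimes>\<^bsub>F\<^esub> (B \<triangleright>\<^bsub>F\<^esub> (A \<star>\<^bsub>F\<^esub> C))"
      using abc lie_class_eq[OF lie_cong.star_mult_right[OF abc]] by (simp add: eq simps)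
    show "(A \<otimes>\<^bsub>F\<^esub> B) \<star>\<^bsub>F\<^esub> C = (A \<triangleright>\<^bsub>F\<^esub> (B \<star>\<^bsub>F\<^esub> C)) \<otimes>\<^bsub>F\<^esub> (A \<star>\<^bsub>F\<^esub> C)"
      using abc lie_class_eq[OF lie_cong.star_mult_left[OF abc]] by (simp add: eq simps)
    show "((A \<star>\<^bsub>F\<^esub> B) \<star>\<^bsub>F\<^esub> (B \<triangleright>\<^bsub>F\<^esub> C)) \<otimes>\<^bsub>F\<^esub> ((B \<star>\<^bsub>F\<^esub> C) \<star>\<^bsub>F\<^esub> (C \<triangleright>\<^bsub>F\<^esub> A))
        \<otimes>\<^bsub>F\<^esub> ((C \<star>\<^bsub>F\<^esub> A) \<star>\<^bsub>F\<^esub> (A \<triangleright>\<^bsub>F\<^esub> B)) = \<one>\<^bsub>F\<^esub>"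
      using abc lie_class_eq[OF lie_cong.star_jacobi[OF abc]] by (simp add: eq simps)
    show "C \<triangleright>\<^bsub>F\<^esub> (A \<star>\<^bsub>F\<^esub> B) = (C \<triangleright>\<^bsub>F\<^esub> A) \<star>\<^bsub>F\<^esub> (C \<triangleright>\<^bsub>F\<^esub> B)"
      using abc lie_class_eq[OF lie_cong.conj_star[OF abc]] by (simp add: eq simps)
  qed
qed

text \<open>Induction on words: if stars of generators stay in the subgroup they generate,
  \<open>star_in_generate\<close> eliminates every \<open>Star\<close> node.\<close>

lemma presented_generate:
  assumes star: "\<And>x y. \<lbrakk>x \<in> X; y \<in> X\<rbrakk> \<Longrightarrow>
      word_class (Star (Gen x) (Gen y)) \<in> generate F ((\<lambda>x. word_class (Gen x)) ` X)"
  shows "carrier F = generate F ((\<lambda>x. word_class (Gen x)) ` X)"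
proof -
  interpret F: mult_lie_algebra F by (rule mult_lie_algebra_presented)
  let ?P = "(\<lambda>x. word_class (Gen x)) ` X"
  have P: "?P \<subseteq> carrier F" by (auto simp: presented_carrier)
  have gens: "A \<star>\<^bsub>F\<^esub> B \<in> generate F ?P" if A: "A \<in> ?P" and B: "B \<in> ?P" for A B
  proof -
    obtain x y where "A = word_class (Gen x)" "B = word_class (Gen y)" "x \<in> X" "y \<in> X"
      using A B by blast
    then show ?thesis using star by (simp add: presented_star)
  qed
  have "word_class w \<in> generate F ?P" if "w \<in> lie_words X" for w
    using that
  proof (induction w)
    case (Gen x)
    then show ?case by (auto intro: generate.incl)
  next
    case One
    then show ?case by (simp add: presented_one[symmetric] generate.one)
  next
    case (Inv u)
    then show ?case
      using F.generate_m_inv_closed[OF P] by (simp add: presented_inv[symmetric])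
  next
    case (Mul u v)
    then show ?case by (simp add: presented_mult[symmetric] generate.eng)
  next
    case (Star u v)
    then have "word_class u \<star>\<^bsub>F\<^esub> word_class v \<in> generate F ?P"
      by (intro F.star_in_generate[OF P gens]) simp_all
    with Star show ?case by (simp add: presented_star)
  qed
  then show ?thesis
    using F.generate_incl[OF P] by (auto simp: presented_carrier)
qed

end

section \<open>Compatible actions\<close>

context lie_action
begin

lemma act_closed [intro, simp]: "\<lbrakk>x \<in> carrier G; y \<in> carrier H\<rbrakk> \<Longrightarrow> \<alpha> x y \<in> carrier H"
  using act_hom by (fastforce simp: hom_def AutoGroup_def BijGroup_def auto_def)

lemma act_mult:
  "\<lbrakk>x \<in> carrier G; y \<in> carrier H; y' \<in> carrier H\<rbrakk> \<Longrightarrow>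
    \<alpha> x (y \<otimes>\<^bsub>H\<^esub> y') = \<alpha> x y \<otimes>\<^bsub>H\<^esub> \<alpha> x y'"
  using act_hom by (fastforce simp: hom_def AutoGroup_def BijGroup_def auto_def)

lemma act_comp:
  assumes "x \<in> carrier G" "x' \<in> carrier G" "y \<in> carrier H"
  shows "\<alpha> (x \<otimes>\<^bsub>G\<^esub> x') y = \<alpha> x (\<alpha> x' y)"
proof -
  have "\<alpha> x \<in> Bij (carrier H)" "\<alpha> x' \<in> Bij (carrier H)"
    using act_hom assms by (auto simp: hom_def AutoGroup_def auto_def)
  moreover have "\<alpha> (x \<otimes>\<^bsub>G\<^esub> x') = \<alpha> x \<otimes>\<^bsub>AutoGroup H\<^esub> \<alpha> x'"
    using act_hom assms by (simp add: hom_def)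
  ultimately show ?thesis
    using assms(3) by (simp add: AutoGroup_def BijGroup_def compose_def)
qed

lemma act_one [simp]: "y \<in> carrier H \<Longrightarrow> \<alpha> \<one>\<^bsub>G\<^esub> y = y"
proof -
  interpret group_hom G "AutoGroup H" \<alpha>
    using act_hom H.AutoGroup by (simp add: group_hom_def group_hom_axioms_def G.is_group)
  show "y \<in> carrier H \<Longrightarrow> \<alpha> \<one>\<^bsub>G\<^esub> y = y"
    using hom_one by (simp add: AutoGroup_def BijGroup_def)
qed

lemma act_unit [simp]: "x \<in> carrier G \<Longrightarrow> \<alpha> x \<one>\<^bsub>H\<^esub> = \<one>\<^bsub>H\<^esub>"
  using act_mult[of x "\<one>\<^bsub>H\<^esub>" "\<one>\<^bsub>H\<^esub>"] by (simp add: H.r_cancel_one')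

lemma act_inv:
  assumes "x \<in> carrier G" "y \<in> carrier H"
  shows "\<alpha> x (inv\<^bsub>H\<^esub> y) = inv\<^bsub>H\<^esub> (\<alpha> x y)"
  using assms act_mult[of x "inv\<^bsub>H\<^esub> y" y] by (simp add: H.inv_equality)

lemma act_conjugate:
  "\<lbrakk>x \<in> carrier G; y \<in> carrier H; y' \<in> carrier H\<rbrakk> \<Longrightarrow>
    \<alpha> x (y \<triangleright>\<^bsub>H\<^esub> y') = \<alpha> x y \<triangleright>\<^bsub>H\<^esub> \<alpha> x y'"
  by (simp add: conjugate_def act_mult act_inv)

lemma act_cancel [simp]:
  assumes "x \<in> carrier G" "y \<in> carrier H"
  shows "\<alpha> (inv\<^bsub>G\<^esub> x) (\<alpha> x y) = y" "\<alpha> x (\<alpha> (inv\<^bsub>G\<^esub> x) y) = y"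
  using assms by (simp_all add: act_comp[symmetric])

lemma bracket_in_carrier [intro, simp]:
  "\<lbrakk>x \<in> carrier G; y \<in> carrier H\<rbrakk> \<Longrightarrow> f x y \<in> carrier H"
  using bracket_closed by blast

end


section \<open>Consequences of compatibility\<close>

context compatible_lie_actions
begin

text \<open>\<open>comm_G\<close> and \<open>comm_H\<close> give the values on x \<otimes> y of
  Brown and Loday's two maps from the tensor product of groups to G and to H.\<close>

definition
  "comm_G x y = x \<otimes>\<^bsub>G\<^esub> \<beta> y (inv\<^bsub>G\<^esub> x)"

definition
  "comm_H x y = \<alpha> x y \<otimes>\<^bsub>H\<^esub> inv\<^bsub>H\<^esub> y"

text \<open>One witness \<open>d\<close> serves both the bracket and the action. For this reason
  \<open>inv (f x y)\<close> times \<open>comm_H x y\<close> is the Lie commutator of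
  \<open>d\<close> and \<open>y\<close>.\<close>

definition
  "inner_acting = {x \<in> carrier G. \<exists>d\<in>carrier H. \<forall>y\<in>carrier H.
    f x y = d \<star>\<^bsub>H\<^esub> y \<and> \<alpha> x y = d \<triangleright>\<^bsub>H\<^esub> y}"

abbreviation "LHG \<equiv> lie_commutator_subgroup G H \<beta> k"
abbreviation "BGH \<equiv> bracket_subgroup G H f"

lemma comm_closed [intro, simp]:
  assumes "x \<in> carrier G" "y \<in> carrier H"
  shows "comm_G x y \<in> carrier G" "comm_H x y \<in> carrier H"
  using assms by (simp_all add: comm_G_def comm_H_def)

text \<open>Compatibility rewrites the action of \<open>\<alpha> x y\<close> as \<open>x\<close>,
  then \<open>y\<close>, then \<open>inv x\<close> in successive action; composing with
  \<open>inv y\<close> leaves conjugation by \<open>x\<close> times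
  \<open>\<beta> y (inv x)\<close>.\<close>

lemma comm_G_conjugate:
  assumes "x \<in> carrier G" "y \<in> carrier H" "x' \<in> carrier G"
  shows "comm_G x y \<triangleright>\<^bsub>G\<^esub> x' = \<beta> (comm_H x y) x'"
proof -
  have "\<beta> (comm_H x y) x' = x \<triangleright>\<^bsub>G\<^esub> \<beta> y (inv\<^bsub>G\<^esub> x \<triangleright>\<^bsub>G\<^esub> \<beta> (inv\<^bsub>H\<^esub> y) x')"
    using assms by (simp add: comm_H_def HG.act_comp compat_act_G)
  also have "\<dots> = x \<triangleright>\<^bsub>G\<^esub> \<beta> y (inv\<^bsub>G\<^esub> x) \<triangleright>\<^bsub>G\<^esub> x'"
    using assms by (simp add: HG.act_conjugate)
  also have "\<dots> = comm_G x y \<triangleright>\<^bsub>G\<^esub> x'"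
    using assms by (simp add: comm_G_def GH.G.mult_conjugate)
  finally show ?thesis by simp
qed

lemma comm_G_act:
  assumes "x \<in> carrier G" "y \<in> carrier H" "y' \<in> carrier H"
  shows "\<alpha> (comm_G x y) y' = comm_H x y \<triangleright>\<^bsub>H\<^esub> y'"
proof -
  have "\<alpha> (comm_G x y) y' = \<alpha> x (y \<triangleright>\<^bsub>H\<^esub> \<alpha> (inv\<^bsub>G\<^esub> x) (inv\<^bsub>H\<^esub> y \<triangleright>\<^bsub>H\<^esub> y'))"
    using assms by (simp add: comm_G_def GH.act_comp compat_act_H)
  also have "\<dots> = \<alpha> x y \<triangleright>\<^bsub>H\<^esub> inv\<^bsub>H\<^esub> y \<triangleright>\<^bsub>H\<^esub> y'"
    using assms by (simp add: GH.act_conjugate)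
  also have "\<dots> = comm_H x y \<triangleright>\<^bsub>H\<^esub> y'"
    using assms by (simp add: comm_H_def GH.H.mult_conjugate)
  finally show ?thesis .
qed

text \<open>Condition (3) of compatibility, solved for one of its factors. Here and in the next
  lemma, \<open>inv (k y x)\<close> and \<open>f x y\<close> are matched just as
  \<open>comm_G x y\<close> and \<open>comm_H x y\<close> are.\<close>

lemma bracket_act_G:
  assumes "x \<in> carrier G" "y \<in> carrier H" "x' \<in> carrier G"
  shows "\<beta> (f x y) x' = inv\<^bsub>G\<^esub> (k y x) \<triangleright>\<^bsub>G\<^esub> x'"
  using assms compat_trivial_G[of x "inv\<^bsub>G\<^esub> (k y x) \<triangleright>\<^bsub>G\<^esub> x'" y] by simp

lemma inv_bracket_act_H:
  assumes "x \<in> carrier G" "y \<in> carrier H" "y' \<in> carrier H"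
  shows "\<alpha> (inv\<^bsub>G\<^esub> (k y x)) y' = f x y \<triangleright>\<^bsub>H\<^esub> y'"
  using assms compat_trivial_H[of x y "\<alpha> (inv\<^bsub>G\<^esub> (k y x)) y'"] by simp

lemma inner_acting_subset: "inner_acting \<subseteq> carrier G"
  by (auto simp: inner_acting_def)

text \<open>The witness \<open>d\<close> is \<open>comm_H x y\<close>: condition (5) handles the
  bracket and \<open>comm_G_act\<close> the action.\<close>

lemma comm_G_inner_acting: "\<lbrakk>x \<in> carrier G; y \<in> carrier H\<rbrakk> \<Longrightarrow> comm_G x y \<in> inner_acting"
  using comm_G_act compat_commutator_H unfolding inner_acting_def
  by (auto simp: comm_G_def comm_H_def)

text \<open>The witness \<open>d\<close> is \<open>f x y\<close>.\<close>

lemma inv_bracket_inner_acting: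
  "\<lbrakk>x \<in> carrier G; y \<in> carrier H\<rbrakk> \<Longrightarrow> inv\<^bsub>G\<^esub> (k y x) \<in> inner_acting"
  using inv_bracket_act_H compat_star_H unfolding inner_acting_def by auto

text \<open>If \<open>d\<close> is a witness for \<open>x\<close>, then the conjugate of
  \<open>d\<close> by \<open>h\<close> is one for \<open>\<beta> h x\<close>.\<close>

lemma act_inner_acting:
  assumes x: "x \<in> inner_acting" and h: "h \<in> carrier H"
  shows "\<beta> h x \<in> inner_acting"
proof -
  obtain d where d: "d \<in> carrier H"
    "\<And>y. y \<in> carrier H \<Longrightarrow> f x y = d \<star>\<^bsub>H\<^esub> y" "\<And>y. y \<in> carrier H \<Longrightarrow> \<alpha> x y = d \<triangleright>\<^bsub>H\<^esub> y"
    and xG: "x \<in> carrier G"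
    using x by (auto simp: inner_acting_def)
  have "f (\<beta> h x) y = (h \<triangleright>\<^bsub>H\<^esub> d) \<star>\<^bsub>H\<^esub> y" if y: "y \<in> carrier H" for y
    using compat_equivariant_H[of x h "inv\<^bsub>H\<^esub> h \<triangleright>\<^bsub>H\<^esub> y"] xG h y d(1)
    by (simp add: d(2) GH.H.conjugate_star)
  moreover have "\<alpha> (\<beta> h x) y = (h \<triangleright>\<^bsub>H\<^esub> d) \<triangleright>\<^bsub>H\<^esub> y" if y: "y \<in> carrier H" for y
    using xG h y d(1)
    by (simp add: compat_act_H d(3)) (simp add: conjugate_def GH.H.m_assoc GH.H.inv_mult_group)
  ultimately show ?thesis
    using d(1) xG h by (auto simp: inner_acting_def)
qed

section \<open>The subgroups ^L[H,G] and \<langle>G,H\<rangle>\<close>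

lemma LHG_gens:
  "{inv\<^bsub>G\<^esub> (k h g) \<otimes>\<^bsub>G\<^esub> (\<beta> h g \<otimes>\<^bsub>G\<^esub> inv\<^bsub>G\<^esub> g) | h g. h \<in> carrier H \<and> g \<in> carrier G}
    \<subseteq> carrier G"
  by auto

lemma LHG_gen:
  "\<lbrakk>x \<in> carrier G; y \<in> carrier H\<rbrakk> \<Longrightarrow>
    inv\<^bsub>G\<^esub> (k y x) \<otimes>\<^bsub>G\<^esub> (\<beta> y x \<otimes>\<^bsub>G\<^esub> inv\<^bsub>G\<^esub> x) \<in> LHG"
  unfolding lie_commutator_subgroup_def by (blast intro: generate.incl)

text \<open>By equivariance, conjugation by \<open>z\<close> carries the generator given by
  \<open>h\<close>, \<open>g\<close> to the one given by \<open>\<alpha> z h\<close> and the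
  conjugate of \<open>g\<close> by \<open>z\<close>.\<close>

lemma LHG_normal: "LHG \<lhd> G"
  unfolding lie_commutator_subgroup_def
proof (rule GH.G.normal_generateI[OF LHG_gens], clarify)
  fix z h g assume z: "z \<in> carrier G" and h: "h \<in> carrier H" and g: "g \<in> carrier G"
  have act: "z \<triangleright>\<^bsub>G\<^esub> \<beta> h g = \<beta> (\<alpha> z h) (z \<triangleright>\<^bsub>G\<^esub> g)"
    using z h g by (simp add: compat_act_G)
  have "z \<triangleright>\<^bsub>G\<^esub> (inv\<^bsub>G\<^esub> (k h g) \<otimes>\<^bsub>G\<^esub> (\<beta> h g \<otimes>\<^bsub>G\<^esub> inv\<^bsub>G\<^esub> g)) =
    inv\<^bsub>G\<^esub> (k (\<alpha> z h) (z \<triangleright>\<^bsub>G\<^esub> g)) \<otimes>\<^bsub>G\<^esub> (\<beta> (\<alpha> z h) (z \<triangleright>\<^bsub>G\<^esub> g) \<otimes>\<^bsub>G\<^esub> inv\<^bsub>G\<^esub> (z \<triangleright>\<^bsub>G\<^esub> g))"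
    using z h g by (simp add: GH.G.conjugate_mult GH.G.conjugate_inv act compat_equivariant_G)
  then show "\<exists>h' g'. z \<otimes>\<^bsub>G\<^esub> (inv\<^bsub>G\<^esub> (k h g) \<otimes>\<^bsub>G\<^esub> (\<beta> h g \<otimes>\<^bsub>G\<^esub> inv\<^bsub>G\<^esub> g)) \<otimes>\<^bsub>G\<^esub> inv\<^bsub>G\<^esub> z =
      inv\<^bsub>G\<^esub> (k h' g') \<otimes>\<^bsub>G\<^esub> (\<beta> h' g' \<otimes>\<^bsub>G\<^esub> inv\<^bsub>G\<^esub> g') \<and> h' \<in> carrier H \<and> g' \<in> carrier G"
    using z h g unfolding conjugate_def by blast
qed

lemma BGH_gens: "{f g h | g h. g \<in> carrier G \<and> h \<in> carrier H} \<subseteq> carrier H"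
  by auto

lemma BGH_gen: "\<lbrakk>x \<in> carrier G; y \<in> carrier H\<rbrakk> \<Longrightarrow> f x y \<in> BGH"
  unfolding bracket_subgroup_def by (blast intro: generate.incl)

lemma BGH_normal: "BGH \<lhd> H"
  unfolding bracket_subgroup_def
proof (rule GH.H.normal_generateI[OF BGH_gens], clarify)
  fix z g h assume "z \<in> carrier H" "g \<in> carrier G" "h \<in> carrier H"
  then show "\<exists>g' h'. z \<otimes>\<^bsub>H\<^esub> f g h \<otimes>\<^bsub>H\<^esub> inv\<^bsub>H\<^esub> z = f g' h' \<and> g' \<in> carrier G \<and> h' \<in> carrier H"
    using compat_equivariant_H[of g z h] unfolding conjugate_def
    by (metis GH.H.conjugate_closed HG.act_closed conjugate_def)
qed

sublocale L: normal LHG G by (rule LHG_normal)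
sublocale B: normal BGH H by (rule BGH_normal)

text \<open>A generator \<open>f g h\<close> acts on G as conjugation by \<open>inv (k h g)\<close>,
  and \<open>LHG\<close> is normal.\<close>

lemma BGH_act_LHG:
  assumes b: "b \<in> BGH" and a: "a \<in> LHG"
  shows "\<beta> b a \<in> LHG"
  using b[unfolded bracket_subgroup_def] a
proof (induction arbitrary: a rule: generate.induct)
  case one
  then show ?case by simp
next
  case (incl z)
  then show ?case by (auto simp: bracket_act_G GH.G.normal_conjugate_closed[OF LHG_normal])
next
  case (inv z)
  then obtain g h where z: "z = f g h" "g \<in> carrier G" "h \<in> carrier H" by auto
  \<comment> \<open>Condition (3) exhibits \<open>a\<close> as the image under \<open>z\<close> of
    its conjugate by \<open>k h g\<close>, so the inverse generator acts as that
    conjugation.\<close>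
  have "\<beta> (inv\<^bsub>H\<^esub> z) a = \<beta> (inv\<^bsub>H\<^esub> z) (\<beta> z (k h g \<triangleright>\<^bsub>G\<^esub> a))"
    using z inv by (simp add: compat_trivial_G)
  also have "\<dots> = k h g \<triangleright>\<^bsub>G\<^esub> a"
    using z inv by simp
  finally show ?case
    using z inv by (simp add: GH.G.normal_conjugate_closed[OF LHG_normal])
next
  case (eng z w)
  then show ?case
    by (metis HG.act_comp B.mem_carrier L.mem_carrier bracket_subgroup_def)
qed

text \<open>The product of \<open>inv (k b a)\<close> and \<open>?c\<close> is a generator of
  \<open>LHG\<close>, and \<open>?c\<close> lies in \<open>LHG\<close> by the preceding lemma, so it
  can be divided off.\<close>

lemma bracket_in_LHG:
  assumes b: "b \<in> BGH" and a: "a \<in> LHG"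
  shows "k b a \<in> LHG"
proof -
  let ?c = "\<beta> b a \<otimes>\<^bsub>G\<^esub> inv\<^bsub>G\<^esub> a"
  have c: "?c \<in> LHG" using BGH_act_LHG[OF b a] a by simp
  have "inv\<^bsub>G\<^esub> (k b a) = (inv\<^bsub>G\<^esub> (k b a) \<otimes>\<^bsub>G\<^esub> ?c) \<otimes>\<^bsub>G\<^esub> inv\<^bsub>G\<^esub> ?c"
    using a b L.mem_carrier[OF c] by (simp add: GH.G.m_assoc)
  then have "inv\<^bsub>G\<^esub> (k b a) \<in> LHG"
    using LHG_gen[of a b] a b c by (metis B.mem_carrier L.m_closed L.m_inv_closed L.mem_carrier)
  then show ?thesis
    using L.m_inv_closed a b by fastforce
qed

end

section \<open>Pairings and the tensor product\<close>

text \<open>An abstract form of the pure tensors. The calculations made here apply both to the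
  tensor product and to its quotient.\<close>

locale lie_pairing =
  compatible_lie_actions G H \<alpha> \<beta> f k + T: mult_lie_algebra T
  for G :: "('a, 'm) mult_lie_scheme" and H :: "('b, 'n) mult_lie_scheme"
    and \<alpha> :: "'a \<Rightarrow> 'b \<Rightarrow> 'b" and \<beta> :: "'b \<Rightarrow> 'a \<Rightarrow> 'a"
    and f :: "'a \<Rightarrow> 'b \<Rightarrow> 'b" and k :: "'b \<Rightarrow> 'a \<Rightarrow> 'a"
    and T :: "('c, 'p) mult_lie_scheme" (structure) +
  fixes p :: "'a \<Rightarrow> 'b \<Rightarrow> 'c"
  assumes pair_closed [intro, simp]:
      "\<lbrakk>x \<in> carrier G; y \<in> carrier H\<rbrakk> \<Longrightarrow> p x y \<in> carrier T"
    and pair_mult_right: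
      "\<lbrakk>x \<in> carrier G; y \<in> carrier H; y' \<in> carrier H\<rbrakk> \<Longrightarrow>
        p x (y \<otimes>\<^bsub>H\<^esub> y') = p x y \<otimes> p (\<beta> y x) (y \<triangleright>\<^bsub>H\<^esub> y')"
    and pair_mult_left:
      "\<lbrakk>x \<in> carrier G; x' \<in> carrier G; y \<in> carrier H\<rbrakk> \<Longrightarrow>
        p (x \<otimes>\<^bsub>G\<^esub> x') y = p (x \<triangleright>\<^bsub>G\<^esub> x') (\<alpha> x y) \<otimes> p x y"
    and pair_star:
      "\<lbrakk>x \<in> carrier G; x' \<in> carrier G; y \<in> carrier H; y' \<in> carrier H\<rbrakk> \<Longrightarrow>
        p x y \<star> p x' y' = p (inv\<^bsub>G\<^esub> (k y x)) (f x' y')"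
    and pair_generate:
      "carrier T = generate T {p x y | x y. x \<in> carrier G \<and> y \<in> carrier H}"
begin

lemma pair_one [simp]: "x \<in> carrier G \<Longrightarrow> p x \<one>\<^bsub>H\<^esub> = \<one>"
  using pair_mult_right[of x "\<one>\<^bsub>H\<^esub>" "\<one>\<^bsub>H\<^esub>"] by (simp add: T.r_cancel_one')

text \<open>Obtained by expanding \<^term>\<open>p (x \<otimes>\<^bsub>G\<^esub> z) (y \<otimes>\<^bsub>H\<^esub> w)\<close> in the two possible orders.\<close>

lemma pair_conjugate:
  assumes x: "x \<in> carrier G" and y: "y \<in> carrier H" and x': "x' \<in> carrier G" and y': "y' \<in> carrier H"
  shows "p x y \<triangleright> p x' y' = p (comm_G x y \<triangleright>\<^bsub>G\<^esub> x') (comm_H x y \<triangleright>\<^bsub>H\<^esub> y')"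
proof -
  have exchange: "p (x \<triangleright>\<^bsub>G\<^esub> \<beta> y z) (\<alpha> x y \<triangleright>\<^bsub>H\<^esub> \<alpha> x w) \<otimes> p x y
      = p x y \<otimes> p (\<beta> y x \<triangleright>\<^bsub>G\<^esub> \<beta> y z) (y \<triangleright>\<^bsub>H\<^esub> \<alpha> x w)"
    if z: "z \<in> carrier G" and w: "w \<in> carrier H" for z w
  proof -
    let ?A = "p (x \<triangleright>\<^bsub>G\<^esub> z) (\<alpha> x y)" and ?B = "p (\<beta> y x) (y \<triangleright>\<^bsub>H\<^esub> w)"
    have "p (x \<otimes>\<^bsub>G\<^esub> z) (y \<otimes>\<^bsub>H\<^esub> w) = p (x \<triangleright>\<^bsub>G\<^esub> z) (\<alpha> x y \<otimes>\<^bsub>H\<^esub> \<alpha> x w) \<otimes> p x (y \<otimes>\<^bsub>H\<^esub> w)"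
      using x y z w by (simp add: pair_mult_left GH.act_mult)
    also have "\<dots> = ?A \<otimes> p (x \<triangleright>\<^bsub>G\<^esub> \<beta> y z) (\<alpha> x y \<triangleright>\<^bsub>H\<^esub> \<alpha> x w) \<otimes> (p x y \<otimes> ?B)"
      using x y z w by (simp add: pair_mult_right compat_act_G)
    finally have 1: "p (x \<otimes>\<^bsub>G\<^esub> z) (y \<otimes>\<^bsub>H\<^esub> w) =
      ?A \<otimes> p (x \<triangleright>\<^bsub>G\<^esub> \<beta> y z) (\<alpha> x y \<triangleright>\<^bsub>H\<^esub> \<alpha> x w) \<otimes> (p x y \<otimes> ?B)" .
    have "p (x \<otimes>\<^bsub>G\<^esub> z) (y \<otimes>\<^bsub>H\<^esub> w) = p (x \<otimes>\<^bsub>G\<^esub> z) y \<otimes> p (\<beta> y x \<otimes>\<^bsub>G\<^esub> \<beta> y z) (y \<triangleright>\<^bsub>H\<^esub> w)"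
      using x y z w by (simp add: pair_mult_right HG.act_mult)
    also have "\<dots> = ?A \<otimes> p x y \<otimes> (p (\<beta> y x \<triangleright>\<^bsub>G\<^esub> \<beta> y z) (y \<triangleright>\<^bsub>H\<^esub> \<alpha> x w) \<otimes> ?B)"
      using x y z w by (simp add: pair_mult_left compat_act_H)
    \<comment> \<open>Both expansions begin with \<open>?A\<close> and end with \<open>?B\<close>,
      which cancel.\<close>
    finally show ?thesis
      using x y z w unfolding 1 by (simp add: T.m_assoc[symmetric]) (simp add: T.m_assoc)
  qed
  have "p (comm_G x y \<triangleright>\<^bsub>G\<^esub> x') (comm_H x y \<triangleright>\<^bsub>H\<^esub> y') \<otimes> p x y = p x y \<otimes> p x' y'"
    \<comment> \<open>These \<open>z\<close> and \<open>w\<close> are chosen so that the right-hand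
      side becomes \<open>p x y \<otimes> p x' y'\<close>; on the left they produce the conjugates
      by \<open>comm_G x y\<close> and \<open>comm_H x y\<close>.\<close>
    using exchange[of "\<beta> (inv\<^bsub>H\<^esub> y) (inv\<^bsub>G\<^esub> (\<beta> y x) \<triangleright>\<^bsub>G\<^esub> x')" "\<alpha> (inv\<^bsub>G\<^esub> x) (inv\<^bsub>H\<^esub> y \<triangleright>\<^bsub>H\<^esub> y')"]
      x y x' y'
    by (simp add: comm_G_def comm_H_def GH.G.mult_conjugate GH.H.mult_conjugate HG.act_inv)
  then show ?thesis
    using x y x' y' by (simp add: conjugate_def T.inv_solve_right')
qed

lemma pair_inv_conjugate:
  assumes x: "x \<in> carrier G" and y: "y \<in> carrier H" and x': "x' \<in> carrier G" and y': "y' \<in> carrier H"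
  shows "inv (p x y) \<triangleright> p x' y' = p (inv\<^bsub>G\<^esub> (comm_G x y) \<triangleright>\<^bsub>G\<^esub> x') (inv\<^bsub>H\<^esub> (comm_H x y) \<triangleright>\<^bsub>H\<^esub> y')"
proof -
  let ?v = "p (inv\<^bsub>G\<^esub> (comm_G x y) \<triangleright>\<^bsub>G\<^esub> x') (inv\<^bsub>H\<^esub> (comm_H x y) \<triangleright>\<^bsub>H\<^esub> y')"
  have "p x y \<triangleright> ?v = p x' y'"
    using assms by (simp add: pair_conjugate)
  then show ?thesis
    using T.conjugate_cancel(1)[of "p x y" ?v] assms by simp
qed

text \<open>The value of \<open>p\<close> at \<open>?g\<close> times \<open>x'\<close> and
  \<open>y'\<close> is expanded twice, once with \<open>?g\<close> as the first factor and once with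
  \<open>x'\<close>. Writing \<open>\<alpha> x' y'\<close> as \<open>?h'\<close> times
  \<open>y'\<close> makes \<open>p ?g y'\<close> the last factor on both sides, where it
  cancels.\<close>

lemma pair_commutator:
  assumes x: "x \<in> carrier G" and y: "y \<in> carrier H" and x': "x' \<in> carrier G" and y': "y' \<in> carrier H"
  shows "commutator T (p x y) (p x' y') = p (comm_G x y) (comm_H x' y')"
proof -
  let ?u = "p x y" and ?v = "p x' y'" and ?g = "comm_G x y" and ?h' = "comm_H x' y'"
  have "p (?g \<otimes>\<^bsub>G\<^esub> x') y' = (?u \<triangleright> ?v) \<otimes> p ?g y'"
    using assms by (simp add: pair_mult_left pair_conjugate comm_G_act)
  moreover have "p (?g \<otimes>\<^bsub>G\<^esub> x') y' = p ?g (\<alpha> x' y') \<otimes> ?v"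
    using assms pair_mult_left[of x' "inv\<^bsub>G\<^esub> x' \<triangleright>\<^bsub>G\<^esub> ?g" y']
    by (simp add: conjugate_def GH.G.m_assoc)
  moreover have "p ?g (\<alpha> x' y') = p ?g ?h' \<otimes> (?v \<triangleright> p ?g y')"
    using assms pair_mult_right[of ?g ?h' y']
    by (simp add: pair_conjugate comm_G_conjugate) (simp add: comm_H_def GH.H.m_assoc)
  ultimately have "(?u \<triangleright> ?v) \<otimes> p ?g y' = p ?g ?h' \<otimes> ?v \<otimes> p ?g y'"
    using assms by (simp add: conjugate_def T.m_assoc)
  then have "?u \<triangleright> ?v = p ?g ?h' \<otimes> ?v"
    using assms by simp
  then show ?thesis
    using assms by (simp add: commutator_def conjugate_def T.m_assoc)
qed

text \<open>Conjugating \<open>p a b\<close> by a pure tensor moves \<open>a\<close> and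
  \<open>b\<close> separately, so normality becomes a stability condition on \<open>A\<close> and
  \<open>B\<close>.\<close>

lemma lie_ideal_pair_generate:
  assumes A: "A \<subseteq> carrier G" and B: "B \<subseteq> carrier H"
    and conj: "\<And>x y a b. \<lbrakk>x \<in> carrier G; y \<in> carrier H; a \<in> A; b \<in> B\<rbrakk> \<Longrightarrow>
      comm_G x y \<triangleright>\<^bsub>G\<^esub> a \<in> A \<and> inv\<^bsub>G\<^esub> (comm_G x y) \<triangleright>\<^bsub>G\<^esub> a \<in> A \<and>
      comm_H x y \<triangleright>\<^bsub>H\<^esub> b \<in> B \<and> inv\<^bsub>H\<^esub> (comm_H x y) \<triangleright>\<^bsub>H\<^esub> b \<in> B"
    and star: "\<And>x y a b. \<lbrakk>x \<in> carrier G; y \<in> carrier H; a \<in> A; b \<in> B\<rbrakk> \<Longrightarrow>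
      p x y \<star> p a b \<in> generate T {p a b | a b. a \<in> A \<and> b \<in> B}"
  shows "lie_ideal (generate T {p a b | a b. a \<in> A \<and> b \<in> B}) T"
proof (rule T.lie_ideal_generateI[OF _ pair_generate])
  fix u s assume "u \<in> {p x y | x y. x \<in> carrier G \<and> y \<in> carrier H}"
    and "s \<in> {p a b | a b. a \<in> A \<and> b \<in> B}"
  then obtain x y a b where u: "u = p x y" "x \<in> carrier G" "y \<in> carrier H"
    and s: "s = p a b" "a \<in> A" "b \<in> B" by blast
  show "u \<triangleright> s \<in> generate T {p a b | a b. a \<in> A \<and> b \<in> B} \<and>
    inv u \<triangleright> s \<in> generate T {p a b | a b. a \<in> A \<and> b \<in> B}"
    using u s A B conj[of x y a b]
    by (auto simp: pair_conjugate pair_inv_conjugate subset_iff intro!: generate.incl)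
  show "u \<star> s \<in> generate T {p a b | a b. a \<in> A \<and> b \<in> B}"
    using u s star by simp
qed (use A B in auto)

abbreviation inner_ideal :: "'b set \<Rightarrow> 'c set"
  where "inner_ideal A \<equiv> generate T {p x y | x y. x \<in> inner_acting \<and> y \<in> A}"

text \<open>Conjugation by \<open>comm_G x y\<close> is the action of \<open>comm_H x y\<close>,
  which preserves \<open>inner_acting\<close>. The star with \<open>p x y\<close> gives the pair of
  \<open>inv (k y x)\<close>, which is inner acting, and \<open>f a b\<close>, which is a star
  \<open>d \<star> b\<close> in H and hence lies in \<open>A\<close>.\<close>

lemma lie_ideal_inner_ideal:
  assumes A: "lie_ideal A H"
  shows "lie_ideal (inner_ideal A) T"
proof (rule lie_ideal_pair_generate)
  interpret A: normal A H using A by (simp add: lie_ideal_def)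
  fix x y a b assume x: "x \<in> carrier G" and y: "y \<in> carrier H" and a: "a \<in> inner_acting" and b: "b \<in> A"
  have aG: "a \<in> carrier G" using a inner_acting_subset by auto
  have "\<beta> (comm_H x y) (inv\<^bsub>G\<^esub> (comm_G x y) \<triangleright>\<^bsub>G\<^esub> a) = a"
    using x y aG comm_G_conjugate[of x y "inv\<^bsub>G\<^esub> (comm_G x y) \<triangleright>\<^bsub>G\<^esub> a"] by simp
  then have "inv\<^bsub>G\<^esub> (comm_G x y) \<triangleright>\<^bsub>G\<^esub> a = \<beta> (inv\<^bsub>H\<^esub> (comm_H x y)) a"
    using x y aG HG.act_cancel(1)[of "comm_H x y" "inv\<^bsub>G\<^esub> (comm_G x y) \<triangleright>\<^bsub>G\<^esub> a"] by simp
  then show "comm_G x y \<triangleright>\<^bsub>G\<^esub> a \<in> inner_acting \<and> inv\<^bsub>G\<^esub> (comm_G x y) \<triangleright>\<^bsub>G\<^esub> a \<in> inner_acting \<and>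
      comm_H x y \<triangleright>\<^bsub>H\<^esub> b \<in> A \<and> inv\<^bsub>H\<^esub> (comm_H x y) \<triangleright>\<^bsub>H\<^esub> b \<in> A"
    using x y a b aG by (simp add: comm_G_conjugate act_inner_acting
        GH.H.normal_conjugate_closed[OF A.normal_axioms])
  obtain d where "d \<in> carrier H" "f a b = d \<star>\<^bsub>H\<^esub> b"
    using a b by (auto simp: inner_acting_def)
  then have "f a b \<in> A"
    using A b by (simp add: lie_ideal_def)
  then show "p x y \<star> p a b \<in> inner_ideal A"
    using x y aG b inv_bracket_inner_acting[of x y] by (auto simp: pair_star intro!: generate.incl)
next
  show "A \<subseteq> carrier H"
    using A by (simp add: lie_ideal_def normal_imp_subgroup subgroup.subset)
qed (rule inner_acting_subset)

lemma lie_ideal_LHG_BGH: "lie_ideal (generate T {p a b | a b. a \<in> LHG \<and> b \<in> BGH}) T"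
proof (rule lie_ideal_pair_generate)
  fix x y a b assume x: "x \<in> carrier G" and y: "y \<in> carrier H" and a: "a \<in> LHG" and b: "b \<in> BGH"
  then show "comm_G x y \<triangleright>\<^bsub>G\<^esub> a \<in> LHG \<and> inv\<^bsub>G\<^esub> (comm_G x y) \<triangleright>\<^bsub>G\<^esub> a \<in> LHG \<and>
      comm_H x y \<triangleright>\<^bsub>H\<^esub> b \<in> BGH \<and> inv\<^bsub>H\<^esub> (comm_H x y) \<triangleright>\<^bsub>H\<^esub> b \<in> BGH"
    by (simp add: GH.G.normal_conjugate_closed[OF LHG_normal] GH.H.normal_conjugate_closed[OF BGH_normal])
  \<comment> \<open>Antisymmetry reverses the star, so that the left factor comes from
    \<open>k b a\<close> in \<open>LHG\<close> and the right factor is the generator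
    \<open>f x y\<close> of \<open>BGH\<close>.\<close>
  have "p x y \<star> p a b = inv (p (inv\<^bsub>G\<^esub> (k b a)) (f x y))"
    using x y a b T.star_antisym[of "p x y" "p a b"] by (simp add: pair_star)
  then show "p x y \<star> p a b \<in> generate T {p a b | a b. a \<in> LHG \<and> b \<in> BGH}"
    using bracket_in_LHG[OF b a] BGH_gen[OF x y] L.m_inv_closed by (auto intro!: generate.inv)
qed (rule L.subset, rule B.subset)

end

section \<open>Nilpotency of the quotient\<close>

text \<open>The situation after the ideal of the theorem has been factored out.\<close>

locale reduced_lie_pairing = lie_pairing +
  assumes pair_trivial: "\<lbrakk>a \<in> LHG; b \<in> BGH\<rbrakk> \<Longrightarrow> p a b = \<one>"
begin

lemma pair_lie_commutator:
  assumes x: "x \<in> carrier G" and y: "y \<in> carrier H" and x': "x' \<in> carrier G" and y': "y' \<in> carrier H"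
  shows "lie_commutator T (p x y) (p x' y') =
    p (\<beta> (f x' y') (comm_G x y)) (f x' y' \<triangleright>\<^bsub>H\<^esub> (inv\<^bsub>H\<^esub> (f x' y') \<otimes>\<^bsub>H\<^esub> comm_H x' y'))"
proof -
  let ?a = "inv\<^bsub>G\<^esub> (k y x)" and ?b = "f x' y'" and ?g = "comm_G x y"
  have g_inv: "inv\<^bsub>G\<^esub> ?g = \<beta> y x \<otimes>\<^bsub>G\<^esub> inv\<^bsub>G\<^esub> x"
    using x y by (simp add: comm_G_def GH.G.inv_mult_group HG.act_inv)
  \<comment> \<open>The inverse of a generator of \<open>LHG\<close>: \<open>?g\<close> and
    \<open>?a\<close> agree modulo \<open>LHG\<close>.\<close>
  have "?g \<otimes>\<^bsub>G\<^esub> inv\<^bsub>G\<^esub> ?a = inv\<^bsub>G\<^esub> (?a \<otimes>\<^bsub>G\<^esub> inv\<^bsub>G\<^esub> ?g)"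
    using x y by (simp add: GH.G.inv_mult_group)
  moreover have "?a \<otimes>\<^bsub>G\<^esub> inv\<^bsub>G\<^esub> ?g \<in> LHG"
    unfolding g_inv using LHG_gen x y by simp
  ultimately have L: "?g \<otimes>\<^bsub>G\<^esub> inv\<^bsub>G\<^esub> ?a \<in> LHG"
    by (metis L.m_inv_closed)
  have B: "\<alpha> ?a ?b \<in> BGH"
    using x y x' y' BGH_gen by (simp add: inv_bracket_act_H GH.H.normal_conjugate_closed[OF BGH_normal])
  \<comment> \<open>Splitting \<open>?g\<close> as \<open>?a\<close> times the rest isolates
    \<open>p ?a ?b\<close>, the star; the other factor pairs \<open>LHG\<close> with
    \<open>BGH\<close> and vanishes.\<close>
  have "p ?g ?b = p (?g \<otimes>\<^bsub>G\<^esub> inv\<^bsub>G\<^esub> ?a) (\<alpha> ?a ?b) \<otimes> p ?a ?b"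
    using x y x' y' pair_mult_left[of ?a "inv\<^bsub>G\<^esub> ?a \<otimes>\<^bsub>G\<^esub> ?g" ?b]
    by (simp add: conjugate_def GH.G.m_assoc)
  also have "\<dots> = p x y \<star> p x' y'"
    unfolding pair_trivial[OF L B] using x y x' y' by (simp add: pair_star)
  finally have "p ?g ?b = p x y \<star> p x' y'" .
  moreover have "commutator T (p x y) (p x' y') = p ?g (?b \<otimes>\<^bsub>H\<^esub> (inv\<^bsub>H\<^esub> ?b \<otimes>\<^bsub>H\<^esub> comm_H x' y'))"
    using x y x' y' by (simp add: pair_commutator)
  ultimately have "commutator T (p x y) (p x' y') = (p x y \<star> p x' y') \<otimes>
      p (\<beta> ?b ?g) (?b \<triangleright>\<^bsub>H\<^esub> (inv\<^bsub>H\<^esub> ?b \<otimes>\<^bsub>H\<^esub> comm_H x' y'))"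
    using x y x' y' pair_mult_right[of ?g ?b "inv\<^bsub>H\<^esub> ?b \<otimes>\<^bsub>H\<^esub> comm_H x' y'"] by simp
  then show ?thesis
    using x y x' y' by (simp add: lie_commutator_def del: GH.H.inv_mult_cancel)
qed

text \<open>One step of the descent. Whatever \<open>X\<close> is, the new left factor is inner
  acting, since it arises from \<open>comm_G\<close> of the first tensor; only the right factor
  depends on \<open>X\<close> and \<open>Y\<close>.\<close>

lemma lie_commutator_inner_ideal:
  assumes A: "lie_ideal A H"
    and X: "X \<subseteq> carrier G" and Y: "Y \<subseteq> carrier H"
    and comm: "\<And>x y. \<lbrakk>x \<in> X; y \<in> Y\<rbrakk> \<Longrightarrow> inv\<^bsub>H\<^esub> (f x y) \<otimes>\<^bsub>H\<^esub> comm_H x y \<in> A"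
    and u: "u \<in> carrier T" and v: "v \<in> generate T {p x y | x y. x \<in> X \<and> y \<in> Y}"
  shows "lie_commutator T u v \<in> inner_ideal A"
proof -
  interpret I: lie_ideal_quotient T "inner_ideal A"
    by unfold_locales (rule lie_ideal_inner_ideal[OF A])
  have "A \<lhd> H" using A by (simp add: lie_ideal_def)
  note conj = GH.H.normal_conjugate_closed[OF this]
  show ?thesis
  proof (rule I.lie_commutator_generate[OF _ _ _ u[unfolded pair_generate] v])
    fix a b assume "a \<in> {p x y | x y. x \<in> carrier G \<and> y \<in> carrier H}"
      and "b \<in> {p x y | x y. x \<in> X \<and> y \<in> Y}"
    then obtain x y x' y' where a: "a = p x y" "x \<in> carrier G" "y \<in> carrier H"
      and b: "b = p x' y'" "x' \<in> X" "y' \<in> Y" by blast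
    have c: "x' \<in> carrier G" "y' \<in> carrier H" using b X Y by auto
    have "\<beta> (f x' y') (comm_G x y) \<in> inner_acting"
      using a c by (simp add: act_inner_acting comm_G_inner_acting)
    moreover have "f x' y' \<triangleright>\<^bsub>H\<^esub> (inv\<^bsub>H\<^esub> (f x' y') \<otimes>\<^bsub>H\<^esub> comm_H x' y') \<in> A"
      using c comm[OF b(2,3)] by (intro conj) auto
    ultimately show "lie_commutator T a b \<in> inner_ideal A"
      unfolding a(1) b(1) pair_lie_commutator[OF a(2,3) c] by (blast intro: generate.incl)
  qed (use X Y in auto)
qed

lemma lower_central_subset:
  "lie_lower_central T (Suc j) \<subseteq> inner_ideal (lie_lower_central H j)"
proof (induction j)
  \<comment> \<open>The first Lie commutator only makes the left factor inner acting; the right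
    factor still ranges over all of H. This is the extra step in the class.\<close>
  case 0
  have H: "lie_ideal (carrier H) H" by (rule GH.H.carrier_lie_ideal)
  show ?case
  proof (rule T.lower_central_Suc_subset)
    show "lie_ideal (inner_ideal (lie_lower_central H 0)) T"
      using lie_ideal_inner_ideal[OF H] by simp
    show "lie_commutator T a b \<in> inner_ideal (lie_lower_central H 0)"
      if "a \<in> carrier T" "b \<in> lie_lower_central T 0" for a b
      using that lie_commutator_inner_ideal[OF H subset_refl subset_refl, of a b]
      by (simp add: pair_generate[symmetric])
  qed
next
  case (Suc j)
  let ?L = "lie_lower_central H"
  note ideal = GH.H.lie_ideal_lower_central
  have sub: "?L j \<subseteq> carrier H"
    using ideal by (simp add: lie_ideal_def normal_imp_subgroup subgroup.subset)
  show ?case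
  proof (rule T.lower_central_Suc_subset)
    show "lie_ideal (inner_ideal (?L (Suc j))) T"
      by (rule lie_ideal_inner_ideal[OF ideal])
    fix a b assume a: "a \<in> carrier T" and b: "b \<in> lie_lower_central T (Suc j)"
    show "lie_commutator T a b \<in> inner_ideal (?L (Suc j))"
    proof (rule lie_commutator_inner_ideal[OF ideal inner_acting_subset sub _ a])
      show "b \<in> inner_ideal (?L j)" using b Suc.IH by blast
      fix x y assume x: "x \<in> inner_acting" and y: "y \<in> ?L j"
      then obtain d where d: "d \<in> carrier H" "f x y = d \<star>\<^bsub>H\<^esub> y" "\<alpha> x y = d \<triangleright>\<^bsub>H\<^esub> y"
        using sub by (auto simp: inner_acting_def)
      \<comment> \<open>With an inner acting left factor, the correction term is a genuine Lie
        commutator in H, so the right factor descends one step.\<close>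
      then have "inv\<^bsub>H\<^esub> (f x y) \<otimes>\<^bsub>H\<^esub> comm_H x y = lie_commutator H d y"
        by (simp add: lie_commutator_def commutator_def comm_H_def conjugate_def)
      then show "inv\<^bsub>H\<^esub> (f x y) \<otimes>\<^bsub>H\<^esub> comm_H x y \<in> ?L (Suc j)"
        using GH.H.lie_commutator_in_lower_central d(1) y by metis
    qed
  qed
qed

text \<open>A pair with right factor the unit is trivial, so the bounding ideal collapses.\<close>

lemma lower_central_trivial:
  assumes "lie_lower_central H n = {\<one>\<^bsub>H\<^esub>}"
  shows "lie_lower_central T (Suc n) = {\<one>}"
proof -
  have "inner_ideal (lie_lower_central H n) \<subseteq> {\<one>}"
    using inner_acting_subset
    by (intro T.generate_subgroup_incl) (auto simp: assms T.triv_subgroup)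
  moreover have "\<one> \<in> lie_lower_central T (Suc n)"
    using T.lie_ideal_lower_central[of "Suc n"]
    by (metis lie_ideal_def normal_imp_subgroup subgroup.one_closed)
  ultimately show ?thesis
    using lower_central_subset[of n] by blast
qed

end

text \<open>The projection is a surjective homomorphism compatible with the star, so the pairing
  laws and the generation property pass to cosets; the pairs of \<open>LHG\<close> and
  \<open>BGH\<close> are generators of \<open>N\<close>.\<close>

lemma (in lie_pairing) reduced_lie_pairing_quotient:
  fixes N
  defines "N \<equiv> generate T {p a b | a b. a \<in> LHG \<and> b \<in> BGH}"
  shows "reduced_lie_pairing G H \<alpha> \<beta> f k (lie_quotient T N) (\<lambda>x y. N #> p x y)"
proof -
  interpret N: lie_ideal_quotient T N
    by unfold_locales (simp add: N_def lie_ideal_LHG_BGH)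
  have P: "{p x y | x y. x \<in> carrier G \<and> y \<in> carrier H} \<subseteq> carrier T" by auto
  show ?thesis
  proof (unfold_locales, goal_cases)
    case (5)
    have "carrier N.Q = (\<lambda>a. N #> a) ` generate T {p x y | x y. x \<in> carrier G \<and> y \<in> carrier H}"
      by (simp add: N.quotient_carrier flip: pair_generate)
    also have "\<dots> = generate N.Q ((\<lambda>a. N #> a) ` {p x y | x y. x \<in> carrier G \<and> y \<in> carrier H})"
      by (rule N.quotient.generate_img[OF P, symmetric])
    also have "(\<lambda>a. N #> a) ` {p x y | x y. x \<in> carrier G \<and> y \<in> carrier H} =
      {N #> p x y | x y. x \<in> carrier G \<and> y \<in> carrier H}" by blast
    finally show ?case .
  next
    case (6 a b)
    then have "p a b \<in> N" unfolding N_def by (blast intro: generate.incl)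
    then show ?case by simp
  qed (simp_all add: pair_mult_left pair_mult_right pair_star N.coset_star)
qed

text \<open>The pairing laws are instances of \<open>tensor_rels\<close>. The star of two pure
  tensors is again a pure tensor, so \<open>presented_generate\<close> applies.\<close>

lemma lie_pairing_tensor:
  assumes "compatible_lie_actions G H \<alpha> \<beta> f k"
  shows "lie_pairing G H \<alpha> \<beta> f k (lie_tensor G H \<alpha> \<beta> f k) (pure_tensor G H \<alpha> \<beta> f k)"
proof -
  interpret compatible_lie_actions G H \<alpha> \<beta> f k by (rule assms)
  let ?X = "carrier G \<times> carrier H" and ?R = "tensor_rels G H \<alpha> \<beta> f k"
  let ?T = "lie_presented ?X ?R" and ?p = "\<lambda>x y. lie_cong ?X ?R `` {Gen (x, y)}"
  interpret T: mult_lie_algebra ?T by (rule mult_lie_algebra_presented)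
  have rel: "lie_cong ?X ?R `` {u} = lie_cong ?X ?R `` {v}"
    if "(u, v) \<in> ?R" "u \<in> lie_words ?X" "v \<in> lie_words ?X" for u v
    using that by (intro lie_class_eq lie_cong.rel)
  have star: "lie_cong ?X ?R `` {Star (Gen (x, y)) (Gen (x', y'))} = ?p (inv\<^bsub>G\<^esub> (k y x)) (f x' y')"
    if "x \<in> carrier G" "y \<in> carrier H" "x' \<in> carrier G" "y' \<in> carrier H" for x y x' y'
    using that by (intro rel tensor_rels.star) auto
  have img: "(\<lambda>z. lie_cong ?X ?R `` {Gen z}) ` ?X = {?p x y | x y. x \<in> carrier G \<and> y \<in> carrier H}"
    by auto
  have "lie_pairing G H \<alpha> \<beta> f k ?T ?p"
  proof
    show "carrier ?T = generate ?T {?p x y | x y. x \<in> carrier G \<and> y \<in> carrier H}"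
      unfolding img[symmetric]
    proof (rule presented_generate)
      fix u v assume "u \<in> ?X" "v \<in> ?X"
      then show "lie_cong ?X ?R `` {Star (Gen u) (Gen v)}
          \<in> generate ?T ((\<lambda>z. lie_cong ?X ?R `` {Gen z}) ` ?X)"
        by (cases u; cases v) (auto simp: star intro!: generate.incl imageI)
    qed
  next
    fix x x' y y'
    assume xy: "x \<in> carrier G" "y \<in> carrier H"
    show "?p x y \<in> carrier ?T"
      using xy by (simp add: presented_carrier)
    show "?p x (y \<otimes>\<^bsub>H\<^esub> y') = ?p x y \<otimes>\<^bsub>?T\<^esub> ?p (\<beta> y x) (y \<triangleright>\<^bsub>H\<^esub> y')" if "y' \<in> carrier H"
      using xy that rel[OF tensor_rels.mult_right[OF xy that]] by (simp add: presented_mult)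
    assume x': "x' \<in> carrier G"
    show "?p (x \<otimes>\<^bsub>G\<^esub> x') y = ?p (x \<triangleright>\<^bsub>G\<^esub> x') (\<alpha> x y) \<otimes>\<^bsub>?T\<^esub> ?p x y"
      using xy x' rel[OF tensor_rels.mult_left[OF xy(1) x' xy(2)]] by (simp add: presented_mult)
    show "?p x y \<star>\<^bsub>?T\<^esub> ?p x' y' = ?p (inv\<^bsub>G\<^esub> (k y x)) (f x' y')" if "y' \<in> carrier H"
      using xy x' that by (simp add: presented_star star)
  qed
  then show ?thesis
    by (simp add: lie_tensor_def pure_tensor_def[abs_def] lie_presented_gen_def)
qed

theorem theorem3p14:
  fixes G :: "('a, 'm) mult_lie_scheme" and H :: "('b, 'n) mult_lie_scheme"
    and \<alpha> :: "'a \<Rightarrow> 'b \<Rightarrow> 'b" and \<beta> :: "'b \<Rightarrow> 'a \<Rightarrow> 'a"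
    and f :: "'a \<Rightarrow> 'b \<Rightarrow> 'b" and k :: "'b \<Rightarrow> 'a \<Rightarrow> 'a"
    and n :: nat
  assumes "compatible_lie_actions G H \<alpha> \<beta> f k"
    and "lie_nilpotent H"
    and "lie_nilpotency_class H = n"
  shows "let Q = lie_quotient (lie_tensor G H \<alpha> \<beta> f k)
      (tensor_subgroup G H \<alpha> \<beta> f k (lie_commutator_subgroup G H \<beta> k) (bracket_subgroup G H f))
    in lie_nilpotent Q \<and> lie_nilpotency_class Q \<le> n + 1"
proof -
  interpret T: lie_pairing G H \<alpha> \<beta> f k "lie_tensor G H \<alpha> \<beta> f k" "pure_tensor G H \<alpha> \<beta> f k"
    by (rule lie_pairing_tensor[OF assms(1)])
  define Q where "Q = lie_quotient (lie_tensor G H \<alpha> \<beta> f k)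
      (tensor_subgroup G H \<alpha> \<beta> f k (lie_commutator_subgroup G H \<beta> k) (bracket_subgroup G H f))"
  \<comment> \<open>Here \<open>p x y\<close> is the coset of the pure tensor of \<open>x\<close>
    and \<open>y\<close>.\<close>
  obtain p where "reduced_lie_pairing G H \<alpha> \<beta> f k Q p"
    using T.reduced_lie_pairing_quotient unfolding Q_def tensor_subgroup_def by blast
  then interpret Q: reduced_lie_pairing G H \<alpha> \<beta> f k Q p .
  \<comment> \<open>Nilpotency ensures that the \<open>LEAST\<close> defining the class is
    attained.\<close>
  have "lie_lower_central H n = {\<one>\<^bsub>H\<^esub>}"
    using assms(2) LeastI_ex[of "\<lambda>j. lie_lower_central H j = {\<one>\<^bsub>H\<^esub>}"]
    by (simp add: lie_nilpotent_def lie_nilpotency_class_def flip: assms(3))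
  then have "lie_lower_central Q (n + 1) = {\<one>\<^bsub>Q\<^esub>}"
    using Q.lower_central_trivial by simp
  then show ?thesis
    using Q.T.mult_lie_algebra_axioms Least_le[of "\<lambda>j. lie_lower_central Q j = {\<one>\<^bsub>Q\<^esub>}"]
    unfolding Q_def[symmetric] Let_def lie_nilpotent_def lie_nilpotency_class_def by blast
qed

end
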